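(* Let $k\ge 1$, and let $(H_k,\ell_{H_k})$ be the one-vertex orientable ribbon graph with $3k$ untwisted edges $e_1,\dots,e_{3k}$, $e_i=\ell_{H_k}(i)$, whose edge-ends are attached around the vertex in the cyclic order $$e_2,\, e_1,\, e_3,\, e_2,\, e_4,\, e_3,\, e_5,\, e_4,\, \ldots,\, e_i,\, e_{i-1},\, e_{i+1},\, e_i,\, \ldots,\, e_{3k},\, e_{3k-1},\, e_1,\, e_{3k}.$$ Let $$\hat\alpha=(\,\underbrace{1,\dots,1}_{k},\ \underbrace{\delta\tau,\dots,\delta\tau}_{k},\ \underbrace{\tau\delta,\dots,\tau\delta}_{k}\,)\in\mathfrak{S}^{3k}.$$ Then the graph $(\hat\alpha,\iota)(H_k,\ell_{H_k})$ is self-trial but not self-dual.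
   Context: **Ribbon graphs.** A (finite) ribbon graph $G=(V(G),E(G))$ is a surface with boundary presented as the union of a set $V(G)$ of discs (vertices) and a set $E(G)$ of discs (edges) such that vertices and edges intersect in disjoint line segments, each such segment lies on the boundary of precisely one vertex and precisely one edge, and every edge contains exactly two such segments. Two ribbon graphs are isomorphic if there is a homeomorphism (not required to preserve any orientation) taking vertices to vertices and edges to edges; equivalently, if the corresponding cellularly embedded graphs are isomorphic. A loop is untwisted if together with its vertex it forms an annulus (not a Möbius band). **Arrow presentations.** A ribbon graph is encoded by drawing each vertex boundary as a circle and recording, for each edge $e$, two directed arcs (arrows) labelled $e$ on the circles, namely the two segments where $e$ meets vertices, directed by an arbitrary orientation of the boundary of the disc $e$. (A loop is untwisted exactly when its two arrows point in the same direction around the vertex circle.) **Operations on one edge.** Let $A,B$ be the two arrows labelled $e$. The partial Petrial (twist) $\tau$ at $e$ reverses the direction of exactly one of $A,B$. The partial dual $\delta$ at $e$: draw a segment with an arrow on it labelled $e$ directed from the head of $A$ to the tail of $B$, and another with an arrow labelled $e$ directed from the head of $B$ to the tail of $A$; then delete $A$, $B$ and the arcs containing them. Vertices may change; the set of edges (labels) is unchanged. It is known that the group $\mathfrak{S} = \langle \delta,\tau \mid \delta^2,\tau^2,(\tau\delta)^3\rangle \cong S_3$ thereby acts on the left on any fixed edge (in a product the rightmost factor is applied first), and operations on distinct edges commute. **Ordered graphs.** $[n]=\{1,\dots,n\}$. $\mathcal{G}_{or(n)}$ is the set of isomorphism classes of pairs $(G,\ell)$, where $G$ is a ribbon graph with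 exactly $n$ edges and $\ell\colon[n]\to E(G)$ is a bijection (a linear ordering of the edges). $(G,\ell_G)$ and $(H,\ell_H)$ are isomorphic if there is a ribbon graph isomorphism $G\to H$ whose edge bijection $g$ satisfies $g\circ\ell_G=\ell_H$. **Group action.** An element $\hat\gamma\in\mathfrak{S}^n$ is regarded as a map $[n]\to\mathfrak{S}$; multiplication in $\mathfrak{S}^n$ is entrywise, and $\hat\gamma\pi$, for $\pi\in S_n$, is composition of maps. $G^{\Gamma(\hat\gamma,\ell)}$ denotes the ribbon graph obtained from $G$ by applying to each edge $e$ the operation $\hat\gamma(\ell^{-1}(e))$. The group $\mathfrak{S}^n\rtimes S_n$, with multiplication $(\hat\gamma_1,\pi_1)(\hat\gamma_2,\pi_2)=(\hat\gamma_1\cdot\hat\gamma_2\pi_1^{-1},\pi_1\pi_2)$, acts on $\mathcal{G}_{or(n)}$ by $(\hat\gamma,\pi)(G,\ell)=(G^{\Gamma(\hat\gamma,\ell\pi^{-1})},\ell\pi^{-1})$. The identity of $S_n$ is $\iota$. **Self-trial, self-dual.** $(G,\ell)\in\mathcal{G}_{or(n)}$ is self-trial if $((g,\dots,g),\pi)(G,\ell)=(G,\ell)$ for some $\pi\in S_n$ with $g=\delta\tau$ or $g=\tau\delta$, and self-dual if $((\delta,\dots,\delta),\pi)(G,\ell)=(G,\ell)$ for some $\pi\in S_n$ (i.e. $G$ is isomorphic to its geometric dual). *)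

theory Defs
  imports Main "HOL-Library.Disjoint_Sets" "HOL-Combinatorics.Permutations"
begin

section \<open>The group generated by partial duality and partial Petriality\<close>

text \<open>
  The group with presentation $\langle \delta, \tau \mid \delta^2, \tau^2, (\tau\delta)^3\rangle$,
  which has order six, is given by the normal forms of its elements; for instance
  \<open>DualTwist\<close> is the product $\delta\tau$.
\<close>

datatype ribbon_op = Unit | Dual | Twist | DualTwist | TwistDual | DualTwistDual

primrec dual_times :: "ribbon_op \<Rightarrow> ribbon_op" where
  "dual_times Unit = Dual"
| "dual_times Dual = Unit"
| "dual_times Twist = DualTwist"
| "dual_times DualTwist = Twist"
| "dual_times TwistDual = DualTwistDual"
| "dual_times DualTwistDual = TwistDual"

primrec twist_times :: "ribbon_op \<Rightarrow> ribbon_op" where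
  "twist_times Unit = Twist"
| "twist_times Dual = TwistDual"
| "twist_times Twist = Unit"
| "twist_times DualTwist = DualTwistDual"
| "twist_times TwistDual = Dual"
| "twist_times DualTwistDual = DualTwist"

instantiation ribbon_op :: monoid_mult
begin

definition one_ribbon_op :: ribbon_op where
  "one_ribbon_op = Unit"

primrec times_ribbon_op :: "ribbon_op \<Rightarrow> ribbon_op \<Rightarrow> ribbon_op" where
  "times_ribbon_op Unit h = h"
| "times_ribbon_op Dual h = dual_times h"
| "times_ribbon_op Twist h = twist_times h"
| "times_ribbon_op DualTwist h = dual_times (twist_times h)"
| "times_ribbon_op TwistDual h = twist_times (dual_times h)"
| "times_ribbon_op DualTwistDual h = dual_times (twist_times (dual_times h))"

instance
proof
  fix a b c :: ribbon_op
  show "a * b * c = a * (b * c)"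
    by (cases a; cases b; cases c) simp_all
  show "1 * a = a" by (simp add: one_ribbon_op_def)
  show "a * 1 = a" by (cases a) (simp_all add: one_ribbon_op_def)
qed

end

lemma ribbon_op_relations:
  "Dual ^ 2 = 1" "Twist ^ 2 = 1" "(Twist * Dual) ^ 3 = 1"
  by (simp_all add: numeral_eq_Suc one_ribbon_op_def)

lemma ribbon_op_normal_forms:
  "Dual * Twist = DualTwist" "Twist * Dual = TwistDual" "Dual * Twist * Dual = DualTwistDual"
  by simp_all

lemma ribbon_op_left_inverse: "\<exists>h. h * g = (1 :: ribbon_op)"
proof (cases g)
  case DualTwist
  then have "TwistDual * g = 1" by (simp add: one_ribbon_op_def)
  then show ?thesis by blast
next
  case TwistDual
  then have "DualTwist * g = 1" by (simp add: one_ribbon_op_def)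
  then show ?thesis by blast
next
  case DualTwistDual
  then have "g * g = 1" by (simp add: one_ribbon_op_def)
  then show ?thesis by blast
qed (auto simp: one_ribbon_op_def intro: exI[of _ Unit] exI[of _ Dual] exI[of _ Twist])


section \<open>Arrow presentations\<close>

text \<open>
  Each edge \<open>e\<close> has two arrows, hence four arrow ends \<open>(e, a, t)\<close>.  Removing all
  arrows from the circles leaves circles without arrows, of which only the number \<open>bare\<close> matters,
  and arcs, each of which is recorded as the set of the two arrow ends that it joins.  The
  circles (the vertex boundaries) are recovered by alternately following arrows and arcs.
\<close>

datatype arrow = First | Second
datatype tip = Tail | Head

type_synonym 'e arrow_end = "'e \<times> arrow \<times> tip"

record 'e ribbon_graph =
  edges :: "'e set"
  arcs :: "'e arrow_end set set"
  bare :: nat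

definition ribbon_graph :: "'e ribbon_graph \<Rightarrow> bool" where
  "ribbon_graph G \<longleftrightarrow>
     finite (edges G) \<and> partition_on (edges G \<times> UNIV) (arcs G) \<and> (\<forall>c \<in> arcs G. card c = 2)"

text \<open>
  Two arrow presentations describe the same ribbon graph iff they differ by a homeomorphism of the
  circles (orientation reversal allowed), by relabelling edges, and by reversing both arrows of
  some edges.  The two arrows of an edge are not distinguished, so they may also be exchanged.
\<close>

primrec other_arrow :: "arrow \<Rightarrow> arrow" where
  "other_arrow First = Second"
| "other_arrow Second = First"

primrec other_tip :: "tip \<Rightarrow> tip" where
  "other_tip Tail = Head"
| "other_tip Head = Tail"

definition edge_symmetry :: "bool \<Rightarrow> bool \<Rightarrow> arrow \<times> tip \<Rightarrow> arrow \<times> tip" where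
  "edge_symmetry exch flip =
     map_prod (if exch then other_arrow else id) (if flip then other_tip else id)"

definition move_ends ::
  "('e \<Rightarrow> 'f) \<Rightarrow> ('e \<Rightarrow> arrow \<times> tip \<Rightarrow> arrow \<times> tip) \<Rightarrow> 'e arrow_end \<Rightarrow> 'f arrow_end" where
  "move_ends g h = (\<lambda>(e, p). (g e, h e p))"

definition ribbon_iso :: "('e \<Rightarrow> 'f) \<Rightarrow> 'e ribbon_graph \<Rightarrow> 'f ribbon_graph \<Rightarrow> bool" where
  "ribbon_iso g G H \<longleftrightarrow>
     bij_betw g (edges G) (edges H) \<and> bare G = bare H \<and>
     (\<exists>exch flip. image (move_ends g (\<lambda>e. edge_symmetry (exch e) (flip e))) ` arcs G = arcs H)"


section \<open>Twisting and dualising\<close>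

text \<open>
  An operation at an edge keeps the four end points of its two arrows and replaces the two arrows.
  It is given by the map that sends the old name of each point to its new name.
  For the partial dual, the new first arrow runs from the head of the old first arrow to the tail
  of the old second one, and the new second arrow from the head of the old second arrow to the
  tail of the old first one.
\<close>

fun dual_end :: "arrow \<times> tip \<Rightarrow> arrow \<times> tip" where
  "dual_end (First, Head) = (First, Tail)"
| "dual_end (Second, Tail) = (First, Head)"
| "dual_end (Second, Head) = (Second, Tail)"
| "dual_end (First, Tail) = (Second, Head)"

fun twist_end :: "arrow \<times> tip \<Rightarrow> arrow \<times> tip" where
  "twist_end (First, t) = (First, other_tip t)"
| "twist_end (Second, t) = (Second, t)"

primrec op_end :: "ribbon_op \<Rightarrow> arrow \<times> tip \<Rightarrow> arrow \<times> tip" where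
  "op_end Unit = id"
| "op_end Dual = dual_end"
| "op_end Twist = twist_end"
| "op_end DualTwist = dual_end \<circ> twist_end"
| "op_end TwistDual = twist_end \<circ> dual_end"
| "op_end DualTwistDual = dual_end \<circ> twist_end \<circ> dual_end"

definition apply_ops :: "('e \<Rightarrow> ribbon_op) \<Rightarrow> 'e ribbon_graph \<Rightarrow> 'e ribbon_graph" where
  "apply_ops f G = G\<lparr>arcs := image (move_ends id (\<lambda>e. op_end (f e))) ` arcs G\<rparr>"


section \<open>Ordered ribbon graphs and the group action\<close>

type_synonym 'e ordered_graph = "'e ribbon_graph \<times> (nat \<Rightarrow> 'e)"

definition ordered_graph :: "nat \<Rightarrow> 'e ordered_graph \<Rightarrow> bool" where
  "ordered_graph n = (\<lambda>(G, l). ribbon_graph G \<and> card (edges G) = n \<and> bij_betw l {1..n} (edges G))"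

definition ordered_iso :: "nat \<Rightarrow> ('e ordered_graph \<times> 'e ordered_graph) set" where
  "ordered_iso n = {((G, l), (H, m)). ordered_graph n (G, l) \<and> ordered_graph n (H, m) \<and>
     (\<exists>g. ribbon_iso g G H \<and> (\<forall>i \<in> {1..n}. g (l i) = m i))}"

definition ordered_classes :: "nat \<Rightarrow> 'e ordered_graph set set" where
  "ordered_classes n = {x. ordered_graph n x} // ordered_iso n"

definition ordered_class :: "nat \<Rightarrow> 'e ordered_graph \<Rightarrow> 'e ordered_graph set" where
  "ordered_class n x = ordered_iso n `` {x}"

text \<open>
  An element of the semidirect product is a pair \<open>(\<gamma>, \<pi>)\<close> where \<open>\<pi>\<close> permutes \<open>{1..n}\<close> and only
  the values of \<open>\<gamma>\<close> on \<open>{1..n}\<close> matter.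
\<close>

type_synonym sd_element = "(nat \<Rightarrow> ribbon_op) \<times> (nat \<Rightarrow> nat)"

fun sd_mult :: "sd_element \<Rightarrow> sd_element \<Rightarrow> sd_element" where
  "sd_mult (\<gamma>1, \<pi>1) (\<gamma>2, \<pi>2) = (\<lambda>i. \<gamma>1 i * \<gamma>2 (inv \<pi>1 i), \<pi>1 \<circ> \<pi>2)"

definition ops_along :: "nat \<Rightarrow> (nat \<Rightarrow> ribbon_op) \<Rightarrow> (nat \<Rightarrow> 'e) \<Rightarrow> 'e \<Rightarrow> ribbon_op" where
  "ops_along n \<gamma> l e = \<gamma> (inv_into {1..n} l e)"

fun act_graph :: "nat \<Rightarrow> sd_element \<Rightarrow> 'e ordered_graph \<Rightarrow> 'e ordered_graph" where
  "act_graph n (\<gamma>, \<pi>) (G, l) = (apply_ops (ops_along n \<gamma> (l \<circ> inv \<pi>)) G, l \<circ> inv \<pi>)"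

definition act :: "nat \<Rightarrow> sd_element \<Rightarrow> 'e ordered_graph set \<Rightarrow> 'e ordered_graph set" where
  "act n x C = (\<Union>y \<in> C. ordered_class n (act_graph n x y))"

definition self_trial :: "nat \<Rightarrow> 'e ordered_graph set \<Rightarrow> bool" where
  "self_trial n C \<longleftrightarrow>
     (\<exists>\<pi> g. \<pi> permutes {1..n} \<and> (g = Dual * Twist \<or> g = Twist * Dual) \<and> act n (\<lambda>_. g, \<pi>) C = C)"

definition self_dual :: "nat \<Rightarrow> 'e ordered_graph set \<Rightarrow> bool" where
  "self_dual n C \<longleftrightarrow> (\<exists>\<pi>. \<pi> permutes {1..n} \<and> act n (\<lambda>_. Dual, \<pi>) C = C)"


section \<open>The action is well defined\<close>

lemma edge_symmetry_simps:
  "edge_symmetry a b (First, t) = (if a then Second else First, if b then other_tip t else t)"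
  "edge_symmetry a b (Second, t) = (if a then First else Second, if b then other_tip t else t)"
  by (simp_all add: edge_symmetry_def)

lemma end_cases:
  obtains "p = (First, Tail)" | "p = (First, Head)" | "p = (Second, Tail)" | "p = (Second, Head)"
  by (cases p; cases "fst p"; cases "snd p") auto

lemma edge_symmetry_comp:
  "edge_symmetry a b (edge_symmetry c d p) = edge_symmetry (a \<noteq> c) (b \<noteq> d) p"
  by (cases p rule: end_cases) (auto simp: edge_symmetry_simps)

lemma edge_symmetry_False: "edge_symmetry False False p = p"
  by (cases p rule: end_cases) (simp_all add: edge_symmetry_simps)

lemma dual_end_edge_symmetry:
  "dual_end (edge_symmetry a b p) = edge_symmetry (a \<noteq> b) b (dual_end p)"
  by (cases p rule: end_cases; cases a; cases b) (simp_all add: edge_symmetry_simps)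

lemma twist_end_edge_symmetry:
  "twist_end (edge_symmetry a b p) = edge_symmetry a (a \<noteq> b) (twist_end p)"
  by (cases p rule: end_cases; cases a; cases b) (simp_all add: edge_symmetry_simps)

lemma dual_end_dual_end: "dual_end (dual_end p) = edge_symmetry True False p"
  by (cases p rule: end_cases) (simp_all add: edge_symmetry_simps)

lemma twist_end_twist_end: "twist_end (twist_end p) = p"
  by (cases p rule: end_cases) simp_all

lemma twist_dual_twist_end:
  "twist_end (dual_end (twist_end p)) = edge_symmetry True True (dual_end (twist_end (dual_end p)))"
  by (cases p rule: end_cases) (simp_all add: edge_symmetry_simps)

lemma op_end_edge_symmetry:
  "\<exists>c d. \<forall>p. op_end g (edge_symmetry a b p) = edge_symmetry c d (op_end g p)"
  proof -
  have *: "\<exists>c d. \<forall>p. op_end g (edge_symmetry a b p) = edge_symmetry c d (op_end g p)"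
    if "\<And>p. op_end g (edge_symmetry a b p) = edge_symmetry c d (op_end g p)" for c d
    using that by blast
  show ?thesis
    by (cases g; rule *) (simp_all only: op_end.simps o_apply id_apply
      dual_end_edge_symmetry twist_end_edge_symmetry)
qed

lemma edge_symmetry_shift:
  assumes "\<exists>a b. \<forall>p. f p = edge_symmetry a b (f' p)"
  shows "\<exists>a b. \<forall>p. dual_end (f p) = edge_symmetry a b (dual_end (f' p))"
    and "\<exists>a b. \<forall>p. twist_end (f p) = edge_symmetry a b (twist_end (f' p))"
proof -
  obtain a b where "\<And>p. f p = edge_symmetry a b (f' p)" using assms by blast
  then have "\<forall>p. dual_end (f p) = edge_symmetry (a \<noteq> b) b (dual_end (f' p))"
    and "\<forall>p. twist_end (f p) = edge_symmetry a (a \<noteq> b) (twist_end (f' p))"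
    by (simp_all only: dual_end_edge_symmetry twist_end_edge_symmetry simp_thms)
  then show "\<exists>a b. \<forall>p. dual_end (f p) = edge_symmetry a b (dual_end (f' p))"
    and "\<exists>a b. \<forall>p. twist_end (f p) = edge_symmetry a b (twist_end (f' p))"
    by blast+
qed

lemma edge_symmetry_chain:
  assumes "\<exists>a b. \<forall>p. f p = edge_symmetry a b (f' p)" "\<exists>a b. \<forall>p. f' p = edge_symmetry a b (f'' p)"
  shows "\<exists>a b. \<forall>p. f p = edge_symmetry a b (f'' p)"
proof -
  obtain a b c d where "\<And>p. f p = edge_symmetry a b (f' p)" "\<And>p. f' p = edge_symmetry c d (f'' p)"
    using assms by blast
  then have "\<forall>p. f p = edge_symmetry (a \<noteq> c) (b \<noteq> d) (f'' p)"
    by (simp only: edge_symmetry_comp simp_thms)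
  then show ?thesis by blast
qed

lemma op_end_dual_times:
  "\<exists>a b. \<forall>p. op_end (dual_times h) p = edge_symmetry a b (dual_end (op_end h p))"
proof -
  have refl: "\<exists>a b. \<forall>p. f p = edge_symmetry a b (f p)" for f
    by (rule exI[of _ False], rule exI[of _ False]) (simp add: edge_symmetry_False)
  have un: "\<exists>a b. \<forall>p. f p = edge_symmetry a b (dual_end (dual_end (f p)))" for f
    by (rule exI[of _ True], rule exI[of _ False])
      (simp add: dual_end_dual_end edge_symmetry_comp edge_symmetry_False)
  show ?thesis
    using refl[of dual_end] un[of id] refl[of "\<lambda>p. dual_end (twist_end p)"] un[of twist_end]
      refl[of "\<lambda>p. dual_end (twist_end (dual_end p))"] un[of "\<lambda>p. twist_end (dual_end p)"]
    by (cases h) simp_all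
qed

lemma op_end_twist_times:
  "\<exists>a b. \<forall>p. op_end (twist_times h) p = edge_symmetry a b (twist_end (op_end h p))"
proof -
  have refl: "\<exists>a b. \<forall>p. f p = edge_symmetry a b (f p)" for f
    by (rule exI[of _ False], rule exI[of _ False]) (simp add: edge_symmetry_False)
  have 1: "\<exists>a b. \<forall>p. dual_end (twist_end (dual_end p)) =
      edge_symmetry a b (twist_end (dual_end (twist_end p)))"
    by (rule exI[of _ True], rule exI[of _ True])
      (simp add: twist_dual_twist_end edge_symmetry_comp edge_symmetry_False)
  have "twist_end (dual_end (twist_end (dual_end p))) = edge_symmetry True False (dual_end (twist_end p))" for p
    by (cases p rule: end_cases) (simp_all add: edge_symmetry_simps)
  then have "dual_end (twist_end p) = edge_symmetry True False (twist_end (dual_end (twist_end (dual_end p))))" for p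
    by (simp add: edge_symmetry_comp edge_symmetry_False)
  then have 2: "\<exists>a b. \<forall>p. dual_end (twist_end p) =
      edge_symmetry a b (twist_end (dual_end (twist_end (dual_end p))))"
    by blast
  show ?thesis
    using refl[of id] refl[of twist_end] refl[of dual_end] 1 2 refl[of "\<lambda>p. twist_end (dual_end p)"]
    by (cases h) (simp_all add: twist_end_twist_end)
qed

lemma op_end_times:
  "\<exists>a b. \<forall>p. op_end (g * h) p = edge_symmetry a b (op_end g (op_end h p))"
proof -
  have D: "\<exists>a b. \<forall>p. op_end (dual_times k) p = edge_symmetry a b (dual_end (f p))"
    if "\<exists>a b. \<forall>p. op_end k p = edge_symmetry a b (f p)" for k f
    by (rule edge_symmetry_chain[OF op_end_dual_times edge_symmetry_shift(1)[OF that]])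
  have T: "\<exists>a b. \<forall>p. op_end (twist_times k) p = edge_symmetry a b (twist_end (f p))"
    if "\<exists>a b. \<forall>p. op_end k p = edge_symmetry a b (f p)" for k f
    by (rule edge_symmetry_chain[OF op_end_twist_times edge_symmetry_shift(2)[OF that]])
  have I: "\<exists>a b. \<forall>p. op_end h p = edge_symmetry a b (op_end h p)"
    by (rule exI[of _ False], rule exI[of _ False]) (simp add: edge_symmetry_False)
  show ?thesis
    using I D[OF I] T[OF I] D[OF T[OF I]] T[OF D[OF I]] D[OF T[OF D[OF I]]]
    by (cases g) simp_all
qed

lemma inj_edge_symmetry: "inj (edge_symmetry a b)"
  by (rule inj_on_inverseI[of _ "edge_symmetry a b"]) (simp add: edge_symmetry_comp edge_symmetry_False)

lemma inj_op_end: "inj (op_end g)"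
proof -
  obtain h where "h * g = 1" using ribbon_op_left_inverse by blast
  then obtain a b where "\<And>p. p = edge_symmetry a b (op_end h (op_end g p))"
    using op_end_times[of h g] by (auto simp: one_ribbon_op_def)
  then show ?thesis by (metis injI)
qed

lemma move_ends_comp: "move_ends g h \<circ> move_ends g' h' = move_ends (g \<circ> g') (\<lambda>e. h (g' e) \<circ> h' e)"
  by (auto simp: move_ends_def)

lemma move_ends_comp_image:
  "image (move_ends g h) ` image (move_ends g' h') ` C = image (move_ends (g \<circ> g') (\<lambda>e. h (g' e) \<circ> h' e)) ` C"
  by (simp add: image_image flip: image_comp move_ends_comp)

lemma move_ends_cong:
  assumes "ribbon_graph G" "\<And>e. e \<in> edges G \<Longrightarrow> g e = g' e" "\<And>e p. e \<in> edges G \<Longrightarrow> h e p = h' e p"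
  shows "image (move_ends g h) ` arcs G = image (move_ends g' h') ` arcs G"
proof (intro image_cong refl)
  fix c x assume "c \<in> arcs G" "x \<in> c"
  then have "x \<in> edges G \<times> UNIV"
    using assms(1) by (auto simp: ribbon_graph_def partition_on_def)
  then show "move_ends g h x = move_ends g' h' x"
    using assms by (auto simp: move_ends_def)
qed

lemma ribbon_graph_apply_ops:
  assumes "ribbon_graph G"
  shows "ribbon_graph (apply_ops f G)"
proof -
  let ?m = "move_ends id (\<lambda>e. op_end (f e))"
  have inj: "inj ?m"
    using inj_op_end by (auto simp: inj_def move_ends_def)
  have "op_end g ` UNIV = UNIV" for g
  proof -
    have "(UNIV :: (arrow \<times> tip) set) = {First, Second} \<times> {Tail, Head}"
      using arrow.exhaust tip.exhaust by auto
    then have "finite (UNIV :: (arrow \<times> tip) set)" by (metis finite.emptyI finite.insertI finite_cartesian_product)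
    then show ?thesis using inj_op_end finite_UNIV_inj_surj by blast
  qed
  then have surj: "\<exists>q. p = op_end g q" for g p by (metis UNIV_I image_iff)
  have im: "?m ` (edges G \<times> UNIV) = edges G \<times> UNIV"
  proof
    show "edges G \<times> UNIV \<subseteq> ?m ` (edges G \<times> UNIV)"
    proof
      fix x assume "x \<in> edges G \<times> (UNIV :: (arrow \<times> tip) set)"
      then obtain e p where x: "x = (e, p)" "e \<in> edges G" by auto
      obtain q where "p = op_end (f e) q" using surj by blast
      then have "x = ?m (e, q)" by (simp add: x move_ends_def)
      then show "x \<in> ?m ` (edges G \<times> UNIV)" using x by blast
    qed
  qed (auto simp: move_ends_def)
  have "partition_on (?m ` (edges G \<times> UNIV)) ((`) ?m ` arcs G - {{}})"
    using assms inj by (intro partition_on_inj_image) (auto simp: ribbon_graph_def intro: inj_on_subset)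
  moreover have "{} \<notin> (`) ?m ` arcs G"
    using assms by (auto simp: ribbon_graph_def partition_on_def)
  moreover have "card (?m ` c) = card c" for c
    using inj by (intro card_image) (auto intro: inj_on_subset)
  ultimately show ?thesis
    using assms by (simp add: im ribbon_graph_def apply_ops_def)
qed

lemma ordered_graph_act_graph:
  assumes "ordered_graph n x" "snd a permutes {1..n}"
  shows "ordered_graph n (act_graph n a x)"
proof -
  obtain \<gamma> \<pi> G l where [simp]: "a = (\<gamma>, \<pi>)" "x = (G, l)" by (cases a; cases x)
  have "bij_betw (inv \<pi>) {1..n} {1..n}"
    using assms by (simp add: permutes_inv permutes_imp_bij)
  then show ?thesis
    using assms ribbon_graph_apply_ops
    by (auto simp: ordered_graph_def apply_ops_def intro: bij_betw_trans)
qed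

lemma ribbon_iso_refl: "ribbon_iso id G G"
  unfolding ribbon_iso_def
  by (auto intro!: exI[of _ "\<lambda>_. False"] simp: edge_symmetry_False move_ends_def image_image)

lemma ribbon_iso_sym:
  assumes "ribbon_graph G" "ribbon_iso g G H"
  shows "ribbon_iso (inv_into (edges G) g) H G"
proof -
  let ?g = "inv_into (edges G) g"
  from assms obtain s r where bij: "bij_betw g (edges G) (edges H)" and b: "bare G = bare H"
    and H: "arcs H = image (move_ends g (\<lambda>e. edge_symmetry (s e) (r e))) ` arcs G"
    unfolding ribbon_iso_def by metis
  have "image (move_ends ?g (\<lambda>e. edge_symmetry (s (?g e)) (r (?g e)))) ` arcs H =
        image (move_ends id (\<lambda>e. id)) ` arcs G"
    unfolding H move_ends_comp_image using bij
    by (intro move_ends_cong assms)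
      (simp_all add: bij_betw_inv_into_left edge_symmetry_comp edge_symmetry_False)
  also have "\<dots> = arcs G" by (auto simp: move_ends_def image_image)
  finally show ?thesis
    unfolding ribbon_iso_def using bij_betw_inv_into[OF bij] b
    by (intro conjI exI[of _ "\<lambda>e. s (?g e)"] exI[of _ "\<lambda>e. r (?g e)"]) simp_all
qed

lemma ribbon_iso_trans:
  assumes "ribbon_iso g G H" "ribbon_iso h H K"
  shows "ribbon_iso (h \<circ> g) G K"
proof -
  from assms(1) obtain s r where bij: "bij_betw g (edges G) (edges H)" and b: "bare G = bare H"
    and H: "image (move_ends g (\<lambda>e. edge_symmetry (s e) (r e))) ` arcs G = arcs H"
    unfolding ribbon_iso_def by blast
  from assms(2) obtain s' r' where bij': "bij_betw h (edges H) (edges K)" and b': "bare H = bare K"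
    and K: "image (move_ends h (\<lambda>e. edge_symmetry (s' e) (r' e))) ` arcs H = arcs K"
    unfolding ribbon_iso_def by blast
  have "image (move_ends (h \<circ> g) (\<lambda>e. edge_symmetry (s' (g e) \<noteq> s e) (r' (g e) \<noteq> r e))) ` arcs G = arcs K"
    unfolding K[symmetric] H[symmetric] move_ends_comp_image by (simp only: comp_def edge_symmetry_comp)
  then have "\<exists>exch flip. image (move_ends (h \<circ> g) (\<lambda>e. edge_symmetry (exch e) (flip e))) ` arcs G = arcs K"
    by - (rule exI[of _ "\<lambda>e. s' (g e) \<noteq> s e"], rule exI[of _ "\<lambda>e. r' (g e) \<noteq> r e"])
  then show ?thesis
    unfolding ribbon_iso_def using bij_betw_trans[OF bij bij'] b b' by (intro conjI) simp_all
qed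

lemma equiv_ordered_iso: "equiv {x :: 'a ordered_graph. ordered_graph n x} (ordered_iso n)"
  (is "equiv ?A ?R")
proof (rule equivI)
  show "?R \<subseteq> ?A \<times> ?A"
    by (auto simp: ordered_iso_def)
  show "refl_on ?A ?R"
  proof (rule refl_onI)
    fix x assume "x \<in> ?A"
    then show "(x, x) \<in> ?R"
      using ribbon_iso_refl[of "fst x"] by (cases x) (auto simp: ordered_iso_def intro!: exI[of _ id])
  qed
  show "sym ?R"
  proof (rule symI)
    fix x y :: "'a ordered_graph" assume "(x, y) \<in> ordered_iso n"
    then obtain G l H m g where xy: "x = (G, l)" "y = (H, m)" "ordered_graph n (G, l)" "ordered_graph n (H, m)"
      and g: "ribbon_iso g G H" "\<forall>i \<in> {1..n}. g (l i) = m i"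
      by (auto simp: ordered_iso_def)
    let ?g = "inv_into (edges G) g"
    have "ribbon_iso ?g H G"
      using xy g by (intro ribbon_iso_sym) (auto simp: ordered_graph_def)
    moreover have "?g (m i) = l i" if "i \<in> {1..n}" for i
    proof -
      have "l i \<in> edges G" using xy that by (auto simp: ordered_graph_def bij_betw_def)
      moreover have "bij_betw g (edges G) (edges H)" using g(1) unfolding ribbon_iso_def by (elim conjE)
      ultimately have "?g (g (l i)) = l i" by (intro bij_betw_inv_into_left)
      then show ?thesis using g(2) that by simp
    qed
    ultimately show "(y, x) \<in> ordered_iso n"
      unfolding ordered_iso_def xy(1,2) mem_Collect_eq case_prod_conv using xy(3,4) by blast
  qed
  show "trans ?R"
  proof (rule transI)
    fix x y z :: "'a ordered_graph" assume "(x, y) \<in> ordered_iso n" "(y, z) \<in> ordered_iso n"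
    then obtain G l H m K q g h where xyz: "x = (G, l)" "y = (H, m)" "z = (K, q)"
      "ordered_graph n (G, l)" "ordered_graph n (K, q)"
      and g: "ribbon_iso g G H" "\<forall>i \<in> {1..n}. g (l i) = m i"
      and h: "ribbon_iso h H K" "\<forall>i \<in> {1..n}. h (m i) = q i"
      by (auto simp: ordered_iso_def)
    have "ribbon_iso (h \<circ> g) G K" "\<forall>i \<in> {1..n}. (h \<circ> g) (l i) = q i"
      using ribbon_iso_trans[OF g(1) h(1)] g(2) h(2) by simp_all
    then show "(x, z) \<in> ordered_iso n"
      unfolding ordered_iso_def xyz(1,3) mem_Collect_eq case_prod_conv using xyz(4,5) by blast
  qed
qed

lemma ordered_class_in_classes:
  "ordered_graph n x \<Longrightarrow> ordered_class n x \<in> ordered_classes n"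
  by (simp add: ordered_class_def ordered_classes_def quotientI)

lemma act_graph_cong:
  assumes "(x, y) \<in> ordered_iso n" "snd a permutes {1..n}"
  shows "(act_graph n a x, act_graph n a y) \<in> ordered_iso n"
proof -
  obtain G l H m g where xy: "x = (G, l)" "y = (H, m)" "ordered_graph n (G, l)" "ordered_graph n (H, m)"
    and g: "ribbon_iso g G H" "\<forall>i \<in> {1..n}. g (l i) = m i"
    using assms(1) by (auto simp: ordered_iso_def)
  obtain \<gamma> \<pi> where a: "a = (\<gamma>, \<pi>)" by (cases a)
  let ?l = "l \<circ> inv \<pi>" and ?m = "m \<circ> inv \<pi>"
  let ?f = "ops_along n \<gamma> ?l" and ?f' = "ops_along n \<gamma> ?m"
  have p: "bij_betw (inv \<pi>) {1..n} {1..n}"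
    using assms(2) a by (simp add: permutes_inv permutes_imp_bij)
  have l: "bij_betw ?l {1..n} (edges G)" and m: "bij_betw ?m {1..n} (edges H)"
    using xy p by (auto simp: ordered_graph_def intro: bij_betw_trans)
  have gm: "\<forall>i \<in> {1..n}. g (?l i) = ?m i"
    using g(2) p by (auto simp: bij_betw_def)
  have ff: "?f' (g e) = ?f e" if "e \<in> edges G" for e
  proof -
    from that l obtain i where i: "i \<in> {1..n}" "e = ?l i" by (metis bij_betw_imp_surj_on imageE)
    have "inv_into {1..n} ?l e = i" using i l by (metis bij_betw_inv_into_left)
    moreover have "inv_into {1..n} ?m (g e) = i" using i m gm by (metis bij_betw_inv_into_left)
    ultimately show ?thesis by (simp add: ops_along_def)
  qed
  from g obtain s r where bij: "bij_betw g (edges G) (edges H)" and b: "bare G = bare H"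
    and H: "arcs H = image (move_ends g (\<lambda>e. edge_symmetry (s e) (r e))) ` arcs G"
    unfolding ribbon_iso_def by metis
  have "\<forall>e. \<exists>c d. \<forall>p. op_end (?f e) (edge_symmetry (s e) (r e) p) = edge_symmetry c d (op_end (?f e) p)"
    using op_end_edge_symmetry by blast
  then obtain c d where cd:
    "\<And>e p. op_end (?f e) (edge_symmetry (s e) (r e) p) = edge_symmetry (c e) (d e) (op_end (?f e) p)"
    by metis
  have "ribbon_graph G" using xy by (simp add: ordered_graph_def)
  then have "image (move_ends g (\<lambda>e. edge_symmetry (c e) (d e))) ` arcs (apply_ops ?f G) = arcs (apply_ops ?f' H)"
    unfolding apply_ops_def
    by (simp add: H move_ends_comp_image del: o_apply) (rule move_ends_cong, auto simp: ff cd)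
  then have "ribbon_iso g (apply_ops ?f G) (apply_ops ?f' H)"
    unfolding ribbon_iso_def using bij b by (auto simp: apply_ops_def)
  then show ?thesis
    using ordered_graph_act_graph[OF xy(3) assms(2)] ordered_graph_act_graph[OF xy(4) assms(2)] gm
    by (auto simp: ordered_iso_def xy a)
qed

lemma act_ordered_class:
  assumes "ordered_graph n x" "snd a permutes {1..n}"
  shows "act n a (ordered_class n x) = ordered_class n (act_graph n a x)"
proof -
  have "ordered_class n (act_graph n a y) = ordered_class n (act_graph n a x)"
    if "y \<in> ordered_class n x" for y
    using that act_graph_cong[of x y n a] assms(2) equiv_class_eq[OF equiv_ordered_iso]
    by (fastforce simp: ordered_class_def)
  moreover have "x \<in> ordered_class n x"
    using equiv_class_self[OF equiv_ordered_iso] assms(1) by (fastforce simp: ordered_class_def)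
  ultimately show ?thesis unfolding act_def by blast
qed

lemma act_graph_mult:
  assumes "ordered_graph n x" "snd a permutes {1..n}" "snd b permutes {1..n}"
  shows "(act_graph n (sd_mult a b) x, act_graph n a (act_graph n b x)) \<in> ordered_iso n"
proof -
  obtain G l where x: "x = (G, l)" by (cases x)
  obtain \<gamma> \<pi> where a: "a = (\<gamma>, \<pi>)" by (cases a)
  obtain \<gamma>' \<pi>' where b: "b = (\<gamma>', \<pi>')" by (cases b)
  have perm: "\<pi> permutes {1..n}" "\<pi>' permutes {1..n}" using assms a b by auto
  have inv: "inv (\<pi> \<circ> \<pi>') = inv \<pi>' \<circ> inv \<pi>"
    using perm by (simp add: o_inv_distrib permutes_bij)
  let ?l1 = "l \<circ> inv \<pi>'" let ?l2 = "?l1 \<circ> inv \<pi>"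
  have p: "bij_betw (inv \<pi>) {1..n} {1..n}" "bij_betw (inv \<pi>') {1..n} {1..n}"
    using perm by (simp_all add: permutes_inv permutes_imp_bij)
  have l1: "bij_betw ?l1 {1..n} (edges G)"
    using assms(1) p x by (auto simp: ordered_graph_def intro: bij_betw_trans)
  have l2: "bij_betw ?l2 {1..n} (edges G)"
    using l1 p by (auto intro: bij_betw_trans)
  have ops: "ops_along n (\<lambda>i. \<gamma> i * \<gamma>' (inv \<pi> i)) ?l2 e = ops_along n \<gamma> ?l2 e * ops_along n \<gamma>' ?l1 e"
    if "e \<in> edges G" for e
  proof -
    from that l2 obtain i where i: "i \<in> {1..n}" "e = ?l2 i" by (metis bij_betw_imp_surj_on imageE)
    have "inv_into {1..n} ?l2 e = i" using i l2 by (metis bij_betw_inv_into_left)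
    moreover have "inv \<pi> i \<in> {1..n}" using p(1) i by (metis bij_betwE)
    then have "inv_into {1..n} ?l1 e = inv \<pi> i"
      using i bij_betw_inv_into_left[OF l1, of "inv \<pi> i"] by simp
    ultimately show ?thesis by (simp add: ops_along_def)
  qed
  let ?f = "ops_along n \<gamma> ?l2" and ?f' = "ops_along n \<gamma>' ?l1"
  let ?h = "ops_along n (\<lambda>i. \<gamma> i * \<gamma>' (inv \<pi> i)) ?l2"
  have "\<forall>e. \<exists>c d. \<forall>p. op_end (?f e * ?f' e) p = edge_symmetry c d (op_end (?f e) (op_end (?f' e) p))"
    using op_end_times by blast
  then obtain c d where cd:
    "\<And>e p. op_end (?f e * ?f' e) p = edge_symmetry (c e) (d e) (op_end (?f e) (op_end (?f' e) p))"
    by metis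
  have G: "ribbon_graph G" using assms(1) x by (simp add: ordered_graph_def)
  have "image (move_ends id (\<lambda>e. edge_symmetry (c e) (d e))) ` arcs (apply_ops ?h G)
      = arcs (apply_ops ?f (apply_ops ?f' G))"
    by (simp add: apply_ops_def move_ends_comp_image, intro move_ends_cong G)
      (simp_all add: ops cd edge_symmetry_comp edge_symmetry_False)
  then have "ribbon_iso id (apply_ops ?h G) (apply_ops ?f (apply_ops ?f' G))"
    unfolding ribbon_iso_def by (auto simp: apply_ops_def)
  then have "\<exists>g. ribbon_iso g (apply_ops ?h G) (apply_ops ?f (apply_ops ?f' G)) \<and>
      (\<forall>i \<in> {1..n}. g (?l2 i) = ?l2 i)"
    by (intro exI[of _ id]) simp
  moreover have "act_graph n (sd_mult a b) x = (apply_ops ?h G, ?l2)"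
    by (simp add: x a b inv o_assoc)
  moreover have "act_graph n a (act_graph n b x) = (apply_ops ?f (apply_ops ?f' G), ?l2)"
    by (simp add: x a b)
  moreover have "snd (sd_mult a b) permutes {1..n}"
    using perm by (simp add: a b permutes_compose)
  then have "ordered_graph n (act_graph n (sd_mult a b) x)"
    using ordered_graph_act_graph assms(1) by blast
  moreover have "ordered_graph n (act_graph n a (act_graph n b x))"
    using ordered_graph_act_graph assms by blast
  ultimately show ?thesis
    unfolding ordered_iso_def by (simp only: mem_Collect_eq case_prod_conv simp_thms)
qed

lemma act_mult:
  assumes "ordered_graph n x" "snd a permutes {1..n}" "snd b permutes {1..n}"
  shows "act n (sd_mult a b) (ordered_class n x) = act n a (act n b (ordered_class n x))"
proof -
  have "snd (sd_mult a b) permutes {1..n}"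
    using assms by (cases a; cases b) (simp add: permutes_compose)
  then show ?thesis
    using equiv_class_eq[OF equiv_ordered_iso act_graph_mult[OF assms]] assms
    by (simp add: act_ordered_class ordered_graph_act_graph ordered_class_def[symmetric]
        del: sd_mult.simps)
qed


section \<open>Orientable one-vertex ribbon graphs\<close>

text \<open>
  A word in which every label occurs exactly twice gives the ribbon graph with one vertex whose
  edge ends are attached in the cyclic order of the word and all of whose edges are untwisted: all
  arrows point forwards along the single circle, so the head of the arrow at each position is
  joined by an arc to the tail of the arrow at the next position.
\<close>

definition arrow_at :: "'e list \<Rightarrow> nat \<Rightarrow> 'e \<times> arrow" where
  "arrow_at w i = (w ! i, if w ! i \<in> set (take i w) then Second else First)"

definition untwisted_bouquet :: "'e list \<Rightarrow> 'e ribbon_graph" where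
  "untwisted_bouquet w = \<lparr>edges = set w,
     arcs = (\<lambda>i. let (e, a) = arrow_at w i; (f, b) = arrow_at w (Suc i mod length w)
                 in {(e, a, Head), (f, b, Tail)}) ` {..<length w},
     bare = 0\<rparr>"

definition H_word :: "nat \<Rightarrow> nat list" where
  "H_word k = concat (map (\<lambda>i. [i, i - 1]) [2..<3 * k + 1]) @ [1, 3 * k]"

definition H_graph :: "nat \<Rightarrow> nat ordered_graph" where
  "H_graph k = (untwisted_bouquet (H_word k), \<lambda>i. i)"

definition alpha :: "nat \<Rightarrow> nat \<Rightarrow> ribbon_op" where
  "alpha k i = (if i \<le> k then 1 else if i \<le> 2 * k then Dual * Twist else Twist * Dual)"

lemma "H_word 2 = [2, 1, 3, 2, 4, 3, 5, 4, 6, 5, 1, 6]"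
  by (simp add: H_word_def upt_rec)

lemma arrow_at_bij:
  assumes "\<forall>x \<in> set w. count_list w x = 2"
  shows "bij_betw (arrow_at w) {..<length w} (set w \<times> UNIV)"
proof -
  have UA: "(UNIV :: arrow set) = {First, Second}" using arrow.exhaust by auto
  have neq: "arrow_at w i \<noteq> arrow_at w j" if ij: "i < j" "j < length w" for i j
  proof
    assume eq: "arrow_at w i = arrow_at w j"
    then have wij: "w ! i = w ! j" by (simp add: arrow_at_def)
    have "w ! j \<in> set (take j w)"
      using ij wij by (metis (no_types, lifting) in_set_conv_nth length_take min.strict_order_iff
          min.commute min_less_iff_conj nth_take order.strict_trans)
    with eq have "w ! i \<in> set (take i w)" by (auto simp: arrow_at_def split: if_splits)
    then obtain m where m: "m < i" "w ! m = w ! i"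
      by (auto simp: in_set_conv_nth)
    have "{m, i, j} \<subseteq> {l. l < length w \<and> w ! i = w ! l}" using m ij wij by auto
    then have "card {m, i, j} \<le> card {l. l < length w \<and> w ! i = w ! l}"
      by (intro card_mono) auto
    also have "\<dots> = count_list w (w ! i)"
      by (simp add: count_list_eq_length_filter length_filter_conv_card)
    also have "\<dots> = 2" using assms ij by simp
    finally show False using m ij by simp
  qed
  have inj: "inj_on (arrow_at w) {..<length w}"
    by (rule inj_onI) (metis lessThan_iff linorder_neqE_nat neq)
  have "length w = (\<Sum>x \<in> set w. count_list w x)" by (simp add: sum_count_set)
  also have "\<dots> = 2 * card (set w)" using assms by simp
  also have "\<dots> = card (set w \<times> (UNIV :: arrow set))" by (simp add: UA card_cartesian_product)
  finally have "card (arrow_at w ` {..<length w}) = card (set w \<times> (UNIV :: arrow set))"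
    using card_image[OF inj] by simp
  then have "arrow_at w ` {..<length w} = set w \<times> UNIV"
    by (intro card_subset_eq) (auto simp: UA arrow_at_def split: if_splits)
  then show ?thesis using inj by (simp add: bij_betw_def)
qed

lemma ribbon_graph_untwisted_bouquet:
  assumes "\<forall>x \<in> set w. count_list w x = 2"
  shows "ribbon_graph (untwisted_bouquet w)"
proof -
  let ?n = "length w"
  define p where "p i = (fst (arrow_at w i), snd (arrow_at w i), Head)" for i
  define q where "q i = (fst (arrow_at w i), snd (arrow_at w i), Tail)" for i
  let ?c = "\<lambda>i. {p i, q (Suc i mod ?n)}"
  have arcs: "arcs (untwisted_bouquet w) = ?c ` {..<?n}"
    by (simp add: untwisted_bouquet_def p_def q_def Let_def case_prod_beta)
  note bij = arrow_at_bij[OF assms]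
  have arrow: "\<exists>i < ?n. arrow_at w i = (e, a)" if "e \<in> set w" for e a
    using bij that by (metis (no_types, lifting) SigmaI UNIV_I bij_betw_imp_surj_on imageE lessThan_iff)
  have inj: "i = j" if "i < ?n" "j < ?n" "arrow_at w i = arrow_at w j" for i j
    using bij that by (metis bij_betw_imp_inj_on inj_onD lessThan_iff)
  have suc: "\<exists>j < ?n. Suc j mod ?n = i" if "i < ?n" for i
  proof (cases i)
    case 0
    with that show ?thesis by (intro exI[of _ "?n - 1"]) auto
  next
    case (Suc j)
    with that show ?thesis by (intro exI[of _ j]) auto
  qed
  have suc_inj: "i = j" if "i < ?n" "j < ?n" "Suc i mod ?n = Suc j mod ?n" for i j
    using that by (auto simp: mod_Suc split: if_splits)
  have mem: "fst (arrow_at w i) \<in> set w" if "i < ?n" for i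
    using that by (simp add: arrow_at_def)
  have disj: "p i \<noteq> q j" for i j by (simp add: p_def q_def)
  have mod: "Suc i mod ?n < ?n" if "i < ?n" for i
    using that by (cases w) auto
  have "partition_on (set w \<times> UNIV) (?c ` {..<?n})"
  proof (rule partition_onI)
    show "\<Union> (?c ` {..<?n}) = set w \<times> UNIV"
    proof
      show "\<Union> (?c ` {..<?n}) \<subseteq> set w \<times> UNIV"
        using mem mod by (auto simp: p_def q_def)
      show "set w \<times> UNIV \<subseteq> \<Union> (?c ` {..<?n})"
      proof
        fix x assume "x \<in> set w \<times> (UNIV :: (arrow \<times> tip) set)"
        then obtain e a t where x: "x = (e, a, t)" "e \<in> set w" by auto
        obtain i where i: "i < ?n" "arrow_at w i = (e, a)" using arrow x by blast
        obtain j where j: "j < ?n" "Suc j mod ?n = i" using suc i by blast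
        show "x \<in> \<Union> (?c ` {..<?n})"
        proof (cases t)
          case Tail
          then have "x = q (Suc j mod ?n)" using i j x by (simp add: q_def)
          then show ?thesis using j by blast
        next
          case Head
          then have "x = p i" using i x by (simp add: p_def)
          then show ?thesis using i by blast
        qed
      qed
    qed
    fix c d assume "c \<in> ?c ` {..<?n}" "d \<in> ?c ` {..<?n}" "c \<noteq> d"
    then obtain i j where ij: "i < ?n" "j < ?n" "i \<noteq> j" "c = ?c i" "d = ?c j" by auto
    have "p i \<noteq> p j" using inj ij(1-3) by (metis Pair_inject p_def prod.collapse)
    moreover have "q (Suc i mod ?n) \<noteq> q (Suc j mod ?n)"
      using inj suc_inj mod ij(1-3) by (metis Pair_inject q_def prod.collapse)
    ultimately show "disjnt c d" using disj by (auto simp: ij disjnt_def)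
  qed auto
  moreover have "\<forall>c \<in> ?c ` {..<?n}. card c = 2" using disj by (auto simp: card_insert_if)
  ultimately show ?thesis
    unfolding ribbon_graph_def arcs by (simp add: untwisted_bouquet_def)
qed

lemma count_list_H_word:
  assumes "k \<ge> 1"
  shows "count_list (H_word k) x = (if x \<in> {1..3 * k} then 2 else 0)"
proof -
  have *: "count_list (concat (map (\<lambda>i. [i, i - 1]) [2..<m + 2])) x =
      (if 2 \<le> x \<and> x \<le> m + 1 then 1 else 0) + (if 1 \<le> x \<and> x \<le> m then 1 else 0)" for m
    by (induction m) auto
  obtain m where m: "3 * k = m + 1" using assms by (metis le_add_diff_inverse2 mult_le_mono2
        mult.right_neutral numeral_One one_le_numeral order_trans)
  have "H_word k = concat (map (\<lambda>i. [i, i - 1]) [2..<m + 2]) @ [1, m + 1]"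
    by (simp only: H_word_def m add.assoc one_add_one)
  then have "count_list (H_word k) x =
      (if 2 \<le> x \<and> x \<le> m + 1 then 1 else 0) + (if 1 \<le> x \<and> x \<le> m then 1 else 0) +
      count_list [1, m + 1] x"
    by (simp only: count_list_append *)
  moreover have "m \<ge> 1" using m assms by linarith
  ultimately show ?thesis unfolding m by (auto split: if_splits)
qed

lemma ordered_graph_H_graph:
  assumes "k \<ge> 1"
  shows "ordered_graph (3 * k) (H_graph k)"
proof -
  have "x \<in> set (H_word k) \<longleftrightarrow> x \<in> {1..3 * k}" for x
    using count_list_H_word[OF assms, of x] count_list_0_iff[of "H_word k" x] by (auto split: if_splits)
  then have set: "set (H_word k) = {1..3 * k}" by blast
  have "ribbon_graph (untwisted_bouquet (H_word k))"
    by (rule ribbon_graph_untwisted_bouquet) (simp add: set count_list_H_word[OF assms])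
  moreover have "edges (untwisted_bouquet (H_word k)) = {1..3 * k}"
    by (simp add: untwisted_bouquet_def set)
  ultimately show ?thesis
    by (simp add: ordered_graph_def H_graph_def bij_betw_def)
qed

end

theory Submission
  imports Defs
begin

text \<open>
  Write $e_1, \dots, e_{3k}$ for the edges of $H_k$, with indices read cyclically.  Up to exchanging
  the names of the two arrows of $e_1$, the arcs of $H_k$ join $e_i$ to $e_{i-1}$ and to $e_{i+2}$
  in a way that does not depend on $i$ (\<open>arcs_untwisted_bouquet_H_word\<close>), so rotating the indices
  is an automorphism.

  Self-triality comes from the rotation $\rho$ by $k$.  Each third of $\hat\alpha$ is $\delta\tau$
  times the previous one, cyclically, so conjugating $(1, \rho)$ by $(\hat\alpha, \iota)$ gives
  $((\delta\tau, \dots, \delta\tau), \rho)$, which therefore fixes $(\hat\alpha, \iota) H_k$.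

  If $((\delta, \dots, \delta), \pi)$ fixed $(\hat\alpha, \iota) H_k$, undoing this conjugation would give
  $(\hat\gamma, \pi)$ fixing $H_k$, where
  $\hat\gamma(i) = \hat\alpha(i)^{-1} \delta \hat\alpha(\pi^{-1}(i))$.  The entries of $\hat\alpha$ lie in
  the subgroup of order three, so every $\hat\gamma(i)$ is one of the three involutions
  $\delta$, $\tau$, $\delta\tau\delta$.  \<open>no_reflection_symmetry\<close> excludes this as follows.

  The four arrow ends of an edge can be split into two pairs in three ways: ends of the same arrow
  (which follows the vertex boundaries), head of one arrow with tail of the other (which follows the
  face boundaries), and ends of different arrows with the same tip.  Given a tip pair, the two arcs
  that leave it lead to edges whose indices differ by $3$ cyclically.  For each of the two other splittings
  there is a pair whose arcs lead to edges that are themselves joined by an arc, hence have indices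
  that differ by $1$ or $2$.  Since $3$ divides $3k$, residues modulo $3$ tell these
  situations apart, so a symmetry preserves the splitting into tip pairs at every edge
  (\<open>no_iso_moves_same_tip_pairing\<close>).  Among the three involutions only $\delta$ preserves
  it, so $\hat\gamma$ is constantly $\delta$, and $H_k$ is isomorphic to its dual.  This is
  absurd because $H_k$ has a single vertex but more than one face: the arcs between $e_i$ and
  $e_{i-1}$ are a union of face boundaries, and so are the remaining arcs
  (\<open>no_iso_faces_to_vertices\<close>).
\<close>

section \<open>A rotationally symmetric arrow presentation\<close>

definition cyc_suc :: "nat \<Rightarrow> nat \<Rightarrow> nat" where
  "cyc_suc n i = (if i = n then 1 else Suc i)"

text \<open>
  The chord diagram in which the first arrow of \<open>i + 1\<close> immediately precedes the second arrow
  of \<open>i\<close>, and the first arrow of \<open>i + 2\<close> immediately follows it.  If there are at least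
  three chords, each crosses exactly its two cyclic neighbours.  Naming the arrows by this rule, and not by their order of
  appearance in a word, makes the arcs invariant under rotation of the labels.
\<close>
definition chord_cycle :: "nat \<Rightarrow> nat ribbon_graph" where
  "chord_cycle n = \<lparr>edges = {1..n},
     arcs = (\<lambda>i. {(cyc_suc n i, First, Head), (i, Second, Tail)}) ` {1..n} \<union>
            (\<lambda>i. {(i, Second, Head), (cyc_suc n (cyc_suc n i), First, Tail)}) ` {1..n},
     bare = 0\<rparr>"

lemma cyc_suc_mem: "i \<in> {1..n} \<Longrightarrow> cyc_suc n i \<in> {1..n}"
  by (auto simp: cyc_suc_def)

lemma cyc_suc_inject:
  "i \<in> {1..n} \<Longrightarrow> j \<in> {1..n} \<Longrightarrow> cyc_suc n i = cyc_suc n j \<longleftrightarrow> i = j"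
  by (auto simp: cyc_suc_def)

lemma cyc_suc_surj:
  assumes "i \<in> {1..n}"
  obtains j where "j \<in> {1..n}" "cyc_suc n j = i"
proof (cases "i = 1")
  case True
  show thesis by (rule that[of n]) (use True assms in \<open>auto simp: cyc_suc_def\<close>)
next
  case False
  show thesis by (rule that[of "i - 1"]) (use False assms in \<open>auto simp: cyc_suc_def\<close>)
qed

lemma edges_chord_cycle [simp]: "edges (chord_cycle n) = {1..n}"
  by (simp add: chord_cycle_def)

lemma bare_chord_cycle [simp]: "bare (chord_cycle n) = 0"
  by (simp add: chord_cycle_def)

lemma arc_chord_cycle_iff:
  "{(i, p), (j, q)} \<in> arcs (chord_cycle n) \<longleftrightarrow> i \<in> {1..n} \<and> j \<in> {1..n} \<and>
     (p = (First, Head) \<and> q = (Second, Tail) \<and> i = cyc_suc n j \<or>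
      p = (Second, Tail) \<and> q = (First, Head) \<and> j = cyc_suc n i \<or>
      p = (Second, Head) \<and> q = (First, Tail) \<and> j = cyc_suc n (cyc_suc n i) \<or>
      p = (First, Tail) \<and> q = (Second, Head) \<and> i = cyc_suc n (cyc_suc n j))"
  using cyc_suc_mem[of _ n] cyc_suc_mem[OF cyc_suc_mem, of _ n]
  by (auto simp: chord_cycle_def doubleton_eq_iff image_iff simp del: atLeastAtMost_iff One_nat_def)

lemma arc_chord_cycle_cases:
  assumes "c \<in> arcs (chord_cycle n)"
  obtains i p j q where "c = {(i, p), (j, q)}" "(i, p) \<noteq> (j, q)" "i \<in> {1..n}" "j \<in> {1..n}"
  using assms cyc_suc_mem[of _ n] cyc_suc_mem[OF cyc_suc_mem, of _ n]
  by (fastforce simp: chord_cycle_def simp del: atLeastAtMost_iff One_nat_def)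

lemma arc_chord_cycle_exists:
  assumes "i \<in> {1..n}"
  obtains j q where "{(i, p), (j, q)} \<in> arcs (chord_cycle n)"
proof -
  obtain a where a: "a \<in> {1..n}" "cyc_suc n a = i" using cyc_suc_surj[OF assms] .
  obtain b where b: "b \<in> {1..n}" "cyc_suc n b = a" using cyc_suc_surj[OF a(1)] .
  have "\<exists>j q. {(i, p), (j, q)} \<in> arcs (chord_cycle n)"
    using assms a b cyc_suc_mem[OF assms] cyc_suc_mem[OF cyc_suc_mem[OF assms]]
    by (cases p rule: end_cases) (auto simp: arc_chord_cycle_iff simp del: atLeastAtMost_iff One_nat_def)
  then show thesis using that by blast
qed

lemma arc_chord_cycle_unique:
  assumes "{(i, p), (j, q)} \<in> arcs (chord_cycle n)" "{(i, p), (j', q')} \<in> arcs (chord_cycle n)"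
  shows "j = j'" "q = q'"
  using assms by (auto simp: arc_chord_cycle_iff cyc_suc_inject cyc_suc_mem simp del: atLeastAtMost_iff One_nat_def)

lemma ribbon_graph_chord_cycle: "ribbon_graph (chord_cycle n)"
proof -
  have "partition_on ({1..n} \<times> UNIV) (arcs (chord_cycle n))"
  proof (rule partition_onI)
    show "\<Union> (arcs (chord_cycle n)) = {1..n} \<times> UNIV"
    proof
      show "\<Union> (arcs (chord_cycle n)) \<subseteq> {1..n} \<times> UNIV"
        by (auto elim!: arc_chord_cycle_cases)
      show "{1..n} \<times> UNIV \<subseteq> \<Union> (arcs (chord_cycle n))"
      proof
        fix x assume "x \<in> {1..n} \<times> (UNIV :: (arrow \<times> tip) set)"
        then obtain i p where x: "x = (i, p)" "i \<in> {1..n}" by auto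
        obtain j q where "{(i, p), (j, q)} \<in> arcs (chord_cycle n)"
          using arc_chord_cycle_exists[OF x(2)] .
        then show "x \<in> \<Union> (arcs (chord_cycle n))" using x by blast
      qed
    qed
    fix c d assume cd: "c \<in> arcs (chord_cycle n)" "d \<in> arcs (chord_cycle n)" "c \<noteq> d"
    have "c = d" if x: "x \<in> c" "x \<in> d" for x
    proof -
      have "\<exists>y. b = {x, y}" if "b \<in> arcs (chord_cycle n)" "x \<in> b" for b
        using that by (auto elim!: arc_chord_cycle_cases)
      then obtain y z where "c = {x, y}" "d = {x, z}" using cd x by metis
      then show ?thesis using arc_chord_cycle_unique cd by (metis prod.collapse)
    qed
    then show "disjnt c d" using cd by (auto simp: disjnt_def)
  qed (auto elim: arc_chord_cycle_cases)
  moreover have "card c = 2" if "c \<in> arcs (chord_cycle n)" for c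
    using that by (elim arc_chord_cycle_cases) simp
  ultimately show ?thesis by (simp add: ribbon_graph_def)
qed

lemma ordered_graph_chord_cycle: "ordered_graph n (chord_cycle n, \<lambda>i. i)"
  by (simp add: ordered_graph_def ribbon_graph_chord_cycle bij_betw_def)

section \<open>Comparison with the given word\<close>

lemma length_H_word: "k \<ge> 1 \<Longrightarrow> length (H_word k) = 6 * k"
  by (simp add: H_word_def length_concat comp_def sum_list_triv)

lemma nth_concat_pairs:
  assumes "j < length xs"
  shows "concat (map (\<lambda>i. [f i, g i]) xs) ! (2 * j) = f (xs ! j)"
    "concat (map (\<lambda>i. [f i, g i]) xs) ! (2 * j + 1) = g (xs ! j)"
  using assms by (induction xs arbitrary: j) (auto simp: nth_Cons split: nat.splits)

lemma nth_H_word: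
  assumes "j < 3 * k"
  shows "H_word k ! (2 * j) = cyc_suc (3 * k) (Suc j)" "H_word k ! (2 * j + 1) = Suc j"
proof -
  define c where "c = concat (map (\<lambda>i. [i, i - 1]) [2..<3 * k + 1])"
  have w: "H_word k = c @ [1, 3 * k]" by (simp only: H_word_def c_def)
  have len: "length c = 2 * (3 * k - 1)"
    unfolding c_def length_concat map_map comp_def by (simp add: sum_list_triv del: upt_Suc)
  have "H_word k ! (2 * j) = cyc_suc (3 * k) (Suc j) \<and> H_word k ! (2 * j + 1) = Suc j"
  proof (cases "Suc j = 3 * k")
    case True
    then have "length c = 2 * j" using len by simp
    then show ?thesis using True by (simp add: w nth_append cyc_suc_def)
  next
    case False
    then have j: "j < length [2..<3 * k + 1]" "Suc (2 * j) < length c" "Suc j < 3 * k"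
      using assms unfolding len length_upt by linarith+
    have "[2..<3 * k + 1] ! j = Suc (Suc j)" using j(3) by (subst nth_upt) linarith+
    then have "c ! (2 * j) = Suc (Suc j)" "c ! (2 * j + 1) = Suc j"
      unfolding c_def nth_concat_pairs[OF j(1), of "\<lambda>i. i" "\<lambda>i. i - 1"] by simp_all
    then show ?thesis using j(2,3) by (simp add: w nth_append cyc_suc_def)
  qed
  then show "H_word k ! (2 * j) = cyc_suc (3 * k) (Suc j)" "H_word k ! (2 * j + 1) = Suc j"
    by simp_all
qed

text \<open>
  The even positions carry the first arrows of \<open>chord_cycle\<close> and the odd positions the second ones;
  because the word starts with the label \<open>2\<close>, this naming is interchanged exactly at the label \<open>1\<close>.
\<close>
lemma arrow_at_H_word:
  assumes "j < 3 * k"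
  shows "arrow_at (H_word k) (2 * j) =
      (cyc_suc (3 * k) (Suc j), if Suc j = 3 * k then Second else First)"
    "arrow_at (H_word k) (2 * j + 1) = (Suc j, if j = 0 then First else Second)"
proof -
  have len: "length (H_word k) = 6 * k" using assms by (simp add: length_H_word)
  have mem: "x \<in> set (take i (H_word k)) \<longleftrightarrow> (\<exists>m < i. H_word k ! m = x)" if "i < 6 * k" for i x
    using that by (auto simp: in_set_conv_nth len)
  have "\<exists>m < 2 * j. H_word k ! m = 1" if "Suc j = 3 * k"
    using that nth_H_word(2)[of 0 k] by (intro exI[of _ 1]) (auto; presburger)
  moreover have "H_word k ! m \<noteq> Suc (Suc j)" if "m < 2 * j" "Suc j \<noteq> 3 * k" for m
  proof (cases "even m")
    case True
    then obtain l where "m = 2 * l" by blast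
    then show ?thesis using that assms nth_H_word(1)[of l k] by (auto simp: cyc_suc_def)
  next
    case False
    then obtain l where "m = 2 * l + 1" by (elim oddE)
    then show ?thesis using that assms nth_H_word(2)[of l k] by auto
  qed
  ultimately show "arrow_at (H_word k) (2 * j) =
      (cyc_suc (3 * k) (Suc j), if Suc j = 3 * k then Second else First)"
    using assms nth_H_word(1)[OF assms] by (auto simp: arrow_at_def mem cyc_suc_def)
  have "\<exists>m < 2 * j + 1. H_word k ! m = Suc j" if "j \<noteq> 0"
    using that assms nth_H_word(1)[of "j - 1" k] by (intro exI[of _ "2 * (j - 1)"]) (auto simp: cyc_suc_def)
  moreover have "H_word k ! 0 \<noteq> 1" if "j = 0"
    using assms that nth_H_word(1)[of 0 k] by (auto simp: cyc_suc_def)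
  ultimately show "arrow_at (H_word k) (2 * j + 1) = (Suc j, if j = 0 then First else Second)"
    using assms nth_H_word(2)[OF assms] by (auto simp: arrow_at_def mem)
qed

lemma arcs_untwisted_bouquet_H_word:
  assumes "k \<ge> 1"
  shows "arcs (untwisted_bouquet (H_word k)) =
    image (move_ends id (\<lambda>i. edge_symmetry (i = 1) False)) ` arcs (chord_cycle (3 * k))"
proof -
  let ?w = "H_word k" and ?n = "3 * k" and ?m = "move_ends id (\<lambda>i. edge_symmetry (i = 1) False)"
  define c where "c i = (let (e, a) = arrow_at ?w i; (f, b) = arrow_at ?w (Suc i mod length ?w)
                 in {(e, a, Head), (f, b, Tail)})" for i
  have len: "length ?w = 2 * ?n" using assms by (simp add: length_H_word)
  have even_arc: "c (2 * j) = ?m ` {(cyc_suc ?n (Suc j), First, Head), (Suc j, Second, Tail)}"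
    if "j < ?n" for j
  proof -
    have "Suc (2 * j) mod length ?w = 2 * j + 1" using that by (simp add: len)
    then show ?thesis
      using that arrow_at_H_word[OF that]
      by (simp add: c_def Let_def move_ends_def edge_symmetry_simps) (auto simp: cyc_suc_def)
  qed
  have odd_arc: "c (2 * j + 1) =
      ?m ` {(Suc j, Second, Head), (cyc_suc ?n (cyc_suc ?n (Suc j)), First, Tail)}"
    if "j < ?n" for j
  proof -
    \<comment> \<open>The position cyclically after \<open>2 * j + 1\<close> is \<open>2 * j'\<close>.\<close>
    define j' where "j' = (if Suc j = ?n then 0 else Suc j)"
    have j': "j' < ?n" "Suc j' = cyc_suc ?n (Suc j)" using that by (auto simp: j'_def cyc_suc_def)
    have "Suc (2 * j + 1) mod length ?w = 2 * j'"
    proof (cases "Suc j = ?n")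
      case True
      then have "Suc (2 * j + 1) = length ?w" by (simp add: len)
      then show ?thesis using True by (simp add: j'_def)
    next
      case False
      then show ?thesis using that by (simp add: len j'_def)
    qed
    then show ?thesis
      using arrow_at_H_word(2)[OF that] arrow_at_H_word(1)[OF j'(1)] j'(2) that
      by (simp add: c_def Let_def move_ends_def edge_symmetry_simps) (auto simp: cyc_suc_def)
  qed
  have "arcs (untwisted_bouquet ?w) = c ` {..<2 * ?n}"
    by (simp add: untwisted_bouquet_def len c_def)
  also have "{..<2 * ?n} = (\<lambda>j. 2 * j) ` {..<?n} \<union> (\<lambda>j. 2 * j + 1) ` {..<?n}"
  proof
    show "{..<2 * ?n} \<subseteq> (\<lambda>j. 2 * j) ` {..<?n} \<union> (\<lambda>j. 2 * j + 1) ` {..<?n}"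
    proof
      fix i assume "i \<in> {..<2 * ?n}"
      then have "i = 2 * (i div 2) \<or> i = 2 * (i div 2) + 1" "i div 2 \<in> {..<?n}" by auto
      then show "i \<in> (\<lambda>j. 2 * j) ` {..<?n} \<union> (\<lambda>j. 2 * j + 1) ` {..<?n}" by blast
    qed
  qed auto
  also have "c ` \<dots> = (\<lambda>j. c (2 * j)) ` {..<?n} \<union> (\<lambda>j. c (2 * j + 1)) ` {..<?n}"
    by (simp only: image_Un image_image)
  also have "\<dots> = image ?m ` ((\<lambda>j. {(cyc_suc ?n (Suc j), First, Head), (Suc j, Second, Tail)}) ` {..<?n} \<union>
      (\<lambda>j. {(Suc j, Second, Head), (cyc_suc ?n (cyc_suc ?n (Suc j)), First, Tail)}) ` {..<?n})"
    unfolding image_Un image_image using even_arc odd_arc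
    by (intro arg_cong2[where f = "(\<union>)"] image_cong refl) auto
  also have "\<dots> = image ?m ` arcs (chord_cycle ?n)"
  proof -
    have "{1..?n} = Suc ` {..<?n}" by (simp add: image_Suc_lessThan)
    then show ?thesis by (simp add: chord_cycle_def image_image del: One_nat_def)
  qed
  finally show ?thesis .
qed

lemma H_graph_iso_chord_cycle:
  assumes "k \<ge> 1"
  shows "((chord_cycle (3 * k), \<lambda>i. i), H_graph k) \<in> ordered_iso (3 * k)"
proof -
  have H: "ordered_graph (3 * k) (untwisted_bouquet (H_word k), \<lambda>i. i)"
    using ordered_graph_H_graph[OF assms] by (simp add: H_graph_def)
  have "x \<in> set (H_word k) \<longleftrightarrow> x \<in> {1..3 * k}" for x
    using count_list_H_word[OF assms, of x] count_list_0_iff[of "H_word k" x]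
    by (auto split: if_splits)
  then have "set (H_word k) = {1..3 * k}" by blast
  then have "edges (untwisted_bouquet (H_word k)) = {1..3 * k}"
    by (simp add: untwisted_bouquet_def)
  moreover have "bare (untwisted_bouquet (H_word k)) = 0"
    by (simp add: untwisted_bouquet_def)
  moreover have "\<exists>exch flip. image (move_ends id (\<lambda>e. edge_symmetry (exch e) (flip e))) `
      arcs (chord_cycle (3 * k)) = arcs (untwisted_bouquet (H_word k))"
    by (rule exI[of _ "\<lambda>e. e = 1"], rule exI[of _ "\<lambda>_. False"])
      (rule arcs_untwisted_bouquet_H_word[OF assms, symmetric])
  ultimately have "ribbon_iso id (chord_cycle (3 * k)) (untwisted_bouquet (H_word k))"
    unfolding ribbon_iso_def by simp
  then have "\<exists>g. ribbon_iso g (chord_cycle (3 * k)) (untwisted_bouquet (H_word k)) \<and>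
      (\<forall>i \<in> {1..3 * k}. g i = i)"
    by (intro exI[of _ id]) simp
  then show ?thesis
    using H ordered_graph_chord_cycle[of "3 * k"] unfolding ordered_iso_def H_graph_def by blast
qed

lemma ordered_class_H_graph:
  assumes "k \<ge> 1"
  shows "ordered_class (3 * k) (H_graph k) = ordered_class (3 * k) (chord_cycle (3 * k), \<lambda>i. i)"
  using equiv_class_eq[OF equiv_ordered_iso H_graph_iso_chord_cycle[OF assms]]
  by (simp add: ordered_class_def)

section \<open>Identities for the action\<close>

lemma act_graph_cong_ops:
  assumes "ordered_graph n x" "\<pi> permutes {1..n}" "\<And>i. i \<in> {1..n} \<Longrightarrow> \<gamma> i = \<gamma>' i"
  shows "act_graph n (\<gamma>, \<pi>) x = act_graph n (\<gamma>', \<pi>) x"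
proof -
  obtain G l where x: "x = (G, l)" by (cases x)
  have G: "ribbon_graph G" and l: "bij_betw l {1..n} (edges G)"
    using assms(1) by (auto simp: x ordered_graph_def)
  have "bij_betw (l \<circ> inv \<pi>) {1..n} (edges G)"
    using assms(2) l by (intro bij_betw_trans) (auto simp: permutes_inv permutes_imp_bij)
  then have "inv_into {1..n} (l \<circ> inv \<pi>) e \<in> {1..n}" if "e \<in> edges G" for e
    using that by (metis bij_betw_imp_surj_on inv_into_into)
  then have "image (move_ends id (\<lambda>e. op_end (ops_along n \<gamma> (l \<circ> inv \<pi>) e))) ` arcs G =
      image (move_ends id (\<lambda>e. op_end (ops_along n \<gamma>' (l \<circ> inv \<pi>) e))) ` arcs G"
    using assms(3) by (intro move_ends_cong[OF G]) (simp_all add: ops_along_def)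
  then show ?thesis by (simp add: x apply_ops_def)
qed

lemma act_cong_ops:
  assumes "ordered_graph n x" "\<pi> permutes {1..n}" "\<And>i. i \<in> {1..n} \<Longrightarrow> \<gamma> i = \<gamma>' i"
  shows "act n (\<gamma>, \<pi>) (ordered_class n x) = act n (\<gamma>', \<pi>) (ordered_class n x)"
  using assms(1,2) act_graph_cong_ops[OF assms] by (simp add: act_ordered_class del: act_graph.simps)

lemma apply_ops_Unit: "apply_ops (\<lambda>_. Unit) G = G"
  by (simp add: apply_ops_def move_ends_def)

lemma act_graph_Unit: "act_graph n (\<lambda>_. Unit, \<pi>) (G, l) = (G, l \<circ> inv \<pi>)"
  by (simp add: ops_along_def[abs_def] apply_ops_Unit)

lemma act_one:
  assumes "ordered_graph n x"
  shows "act n (\<lambda>_. Unit, id) (ordered_class n x) = ordered_class n x"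
proof -
  have "act_graph n (\<lambda>_. Unit, id) x = x" by (cases x) (simp only: act_graph_Unit inv_id comp_id)
  then show ?thesis using assms by (simp add: act_ordered_class permutes_id)
qed

section \<open>Rotation and self-triality\<close>

definition rotate_third :: "nat \<Rightarrow> nat \<Rightarrow> nat" where
  "rotate_third k i = (if i \<notin> {1..3 * k} then i else if i \<le> 2 * k then i + k else i - 2 * k)"

lemma rotate_third_permutes: "rotate_third k permutes {1..3 * k}"
proof (rule bij_imp_permutes)
  have "inj_on (rotate_third k) {1..3 * k}" by (auto simp: inj_on_def rotate_third_def split: if_splits)
  moreover have "rotate_third k ` {1..3 * k} \<subseteq> {1..3 * k}" by (auto simp: rotate_third_def)
  ultimately show "bij_betw (rotate_third k) {1..3 * k} {1..3 * k}"
    by (simp add: bij_betw_def endo_inj_surj)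
qed (auto simp: rotate_third_def)

lemma cyc_suc_rotate_third:
  "i \<in> {1..3 * k} \<Longrightarrow> rotate_third k (cyc_suc (3 * k) i) = cyc_suc (3 * k) (rotate_third k i)"
  by (auto simp: rotate_third_def cyc_suc_def)

lemma ribbon_iso_commuting_cyc_suc:
  assumes "bij_betw f {1..n} {1..n}" "\<And>i. i \<in> {1..n} \<Longrightarrow> f (cyc_suc n i) = cyc_suc n (f i)"
  shows "ribbon_iso f (chord_cycle n) (chord_cycle n)"
proof -
  let ?A = "\<lambda>i. {(cyc_suc n i, First, Head), (i, Second, Tail)}"
  let ?B = "\<lambda>i. {(i, Second, Head), (cyc_suc n (cyc_suc n i), First, Tail)}"
  let ?m = "move_ends f (\<lambda>e. edge_symmetry False False)"
  have A: "?m ` ?A i = ?A (f i)" and B: "?m ` ?B i = ?B (f i)" if "i \<in> {1..n}" for i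
    using that assms(2) cyc_suc_mem[OF that]
    by (simp_all add: move_ends_def edge_symmetry_False del: atLeastAtMost_iff One_nat_def)
  have "image ?m ` arcs (chord_cycle n) = (\<lambda>i. ?m ` ?A i) ` {1..n} \<union> (\<lambda>i. ?m ` ?B i) ` {1..n}"
    by (simp only: chord_cycle_def ribbon_graph.simps image_Un image_image)
  also have "\<dots> = ?A ` f ` {1..n} \<union> ?B ` f ` {1..n}"
    unfolding image_image using A B by (intro arg_cong2[where f = "(\<union>)"] image_cong refl)
  also have "\<dots> = arcs (chord_cycle n)"
    using assms(1) by (simp only: bij_betw_imp_surj_on chord_cycle_def ribbon_graph.simps)
  finally show ?thesis
    unfolding ribbon_iso_def using assms(1)
    by (intro conjI exI[of _ "\<lambda>_. False"]) simp_all
qed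

lemma act_rotate_third:
  "act (3 * k) (\<lambda>_. Unit, rotate_third k) (ordered_class (3 * k) (chord_cycle (3 * k), \<lambda>i. i)) =
   ordered_class (3 * k) (chord_cycle (3 * k), \<lambda>i. i)"
proof -
  let ?M = "chord_cycle (3 * k)" and ?r = "rotate_third k"
  note perm = rotate_third_permutes[of k]
  have og: "ordered_graph (3 * k) (?M, \<lambda>i. i)" by (rule ordered_graph_chord_cycle)
  have eq: "act_graph (3 * k) (\<lambda>_. Unit, ?r) (?M, \<lambda>i. i) = (?M, inv ?r)"
    by (simp only: act_graph_Unit) (simp add: comp_def)
  have "ordered_graph (3 * k) (act_graph (3 * k) (\<lambda>_. Unit, ?r) (?M, \<lambda>i. i))"
    using perm by (intro ordered_graph_act_graph[OF og]) simp
  then have og': "ordered_graph (3 * k) (?M, inv ?r)" by (simp only: eq)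
  have "ribbon_iso ?r ?M ?M"
    using perm cyc_suc_rotate_third by (intro ribbon_iso_commuting_cyc_suc permutes_imp_bij)
  moreover have "\<forall>i \<in> {1..3 * k}. ?r (inv ?r i) = i" using permutes_inverses(1)[OF perm] by simp
  ultimately have "((?M, inv ?r), (?M, \<lambda>i. i)) \<in> ordered_iso (3 * k)"
    using og og' unfolding ordered_iso_def by blast
  then have "ordered_class (3 * k) (?M, inv ?r) = ordered_class (3 * k) (?M, \<lambda>i. i)"
    unfolding ordered_class_def by (rule equiv_class_eq[OF equiv_ordered_iso])
  then show ?thesis
    using act_ordered_class[OF og, of "(\<lambda>_. Unit, ?r)"] perm eq by (simp del: act_graph.simps)
qed

text \<open>
  Passing to the next third multiplies the value of \<open>alpha\<close> by $\delta\tau$; this closes up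
  from the last third to the first because $\delta\tau$ has order three.
\<close>
lemma alpha_rotate_third:
  assumes "i \<in> {1..3 * k}"
  shows "DualTwist * alpha k (inv (rotate_third k) i) = alpha k i"
proof -
  note perm = rotate_third_permutes[of k]
  define j where "j = inv (rotate_third k) i"
  have j: "j \<in> {1..3 * k}" "i = rotate_third k j"
    using assms permutes_in_image[OF permutes_inv[OF perm]] permutes_inverses(1)[OF perm]
    by (auto simp: j_def)
  have "DualTwist * alpha k j = alpha k (rotate_third k j)"
    using j(1) by (auto simp: alpha_def rotate_third_def one_ribbon_op_def)
  then show ?thesis by (simp only: j(2)[symmetric] j_def[symmetric])
qed

text \<open>
  In the group, $((\delta\tau, \dots, \delta\tau), \rho)(\hat\alpha, \iota) =
  (\hat\alpha, \rho) = (\hat\alpha, \iota)(1, \rho)$ for the rotation $\rho$.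
\<close>
lemma self_trial_alpha_chord_cycle:
  "self_trial (3 * k)
     (act (3 * k) (alpha k, id) (ordered_class (3 * k) (chord_cycle (3 * k), \<lambda>i. i)))"
proof -
  let ?r = "rotate_third k"
  let ?act = "act (3 * k)" and ?C = "ordered_class (3 * k) (chord_cycle (3 * k), \<lambda>i. i)"
  note og = ordered_graph_chord_cycle[of "3 * k"] and perm = rotate_third_permutes[of k]
  have "?act (\<lambda>_. DualTwist, ?r) (?act (alpha k, id) ?C) =
      ?act (\<lambda>i. DualTwist * alpha k (inv ?r i), ?r) ?C"
    using act_mult[OF og, of "(\<lambda>_. DualTwist, ?r)" "(alpha k, id)"] perm by (simp add: permutes_id)
  also have "\<dots> = ?act (alpha k, ?r) ?C"
    using alpha_rotate_third by (intro act_cong_ops og perm)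
  also have "\<dots> = ?act (alpha k, id) (?act (\<lambda>_. Unit, ?r) ?C)"
    using act_mult[OF og, of "(alpha k, id)" "(\<lambda>_. Unit, ?r)"] perm
    by (simp add: permutes_id flip: one_ribbon_op_def)
  also have "\<dots> = ?act (alpha k, id) ?C" by (simp only: act_rotate_third)
  finally have "?act (\<lambda>_. Dual * Twist, ?r) (?act (alpha k, id) ?C) = ?act (alpha k, id) ?C"
    by simp
  then show ?thesis unfolding self_trial_def using perm by blast
qed

section \<open>Residues of the labels modulo three\<close>

lemma cyc_suc_mod_3: "3 dvd n \<Longrightarrow> i \<in> {1..n} \<Longrightarrow> cyc_suc n i mod 3 = Suc i mod 3"
  by (auto simp: cyc_suc_def)

lemma cyc_suc_cyc_suc_mod_3:
  "3 dvd n \<Longrightarrow> i \<in> {1..n} \<Longrightarrow> cyc_suc n (cyc_suc n i) mod 3 = Suc (Suc i) mod 3"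
  by (metis cyc_suc_mem cyc_suc_mod_3 mod_Suc_eq)

lemma arc_labels_mod_3:
  assumes "3 dvd n" "{(i, p), (j, q)} \<in> arcs (chord_cycle n)"
  shows "i mod 3 \<noteq> j mod 3"
proof -
  have neq: "Suc i mod 3 \<noteq> i mod 3" "Suc (Suc i) mod 3 \<noteq> i mod 3" for i :: nat by presburger+
  have "j mod 3 = Suc i mod 3 \<or> i mod 3 = Suc j mod 3 \<or>
      j mod 3 = Suc (Suc i) mod 3 \<or> i mod 3 = Suc (Suc j) mod 3"
    using assms cyc_suc_mod_3 cyc_suc_cyc_suc_mod_3 unfolding arc_chord_cycle_iff by blast
  then show ?thesis using neq by metis
qed

text \<open>
  \<open>edge_symmetry True False\<close> exchanges the ends with the same tip.  The arcs at the two heads of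
  \<open>e\<close> lead to the labels \<open>e - 1\<close> and \<open>e + 2\<close>, those at the two tails to \<open>e - 2\<close> and \<open>e + 1\<close>.
\<close>
lemma same_tip_neighbours_mod_3:
  assumes "3 dvd n" "{(e, p), (i, q)} \<in> arcs (chord_cycle n)"
    "{(e, edge_symmetry True False p), (j, r)} \<in> arcs (chord_cycle n)"
  shows "i mod 3 = j mod 3"
proof -
  have nbr: "(t = (First, Head) \<longrightarrow> e mod 3 = Suc l mod 3) \<and>
      (t = (First, Tail) \<longrightarrow> e mod 3 = Suc (Suc l) mod 3) \<and>
      (t = (Second, Head) \<longrightarrow> l mod 3 = Suc (Suc e) mod 3) \<and>
      (t = (Second, Tail) \<longrightarrow> l mod 3 = Suc e mod 3)"
    if "{(e, t), (l, u)} \<in> arcs (chord_cycle n)" for t l u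
    using that cyc_suc_mod_3[OF assms(1)] cyc_suc_cyc_suc_mod_3[OF assms(1)]
    unfolding arc_chord_cycle_iff by auto
  have "e mod 3 = Suc i mod 3 \<and> j mod 3 = Suc (Suc e) mod 3 \<or>
      e mod 3 = Suc (Suc i) mod 3 \<and> j mod 3 = Suc e mod 3 \<or>
      i mod 3 = Suc (Suc e) mod 3 \<and> e mod 3 = Suc j mod 3 \<or>
      i mod 3 = Suc e mod 3 \<and> e mod 3 = Suc (Suc j) mod 3"
    using nbr[OF assms(2)] nbr[OF assms(3)]
    by (cases p rule: end_cases) (simp_all add: edge_symmetry_simps)
  then show ?thesis by (elim disjE conjE) (simp_all add: mod_Suc split: if_splits)
qed

text \<open>
  The arc at the first head leads to the label \<open>e - 1\<close>.  The end paired with this head is the first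
  tail, whose arc leads to \<open>e - 2\<close>, or the second tail, whose arc leads to \<open>e + 1\<close>; both
  these labels are joined to \<open>e - 1\<close>.  The choice of the first head matters: for \<open>n \<ge> 7\<close> the arcs at
  \<open>(First, Tail)\<close> and \<open>(Second, Head)\<close> lead to the labels \<open>e - 2\<close> and \<open>e + 2\<close>, which are not joined.
\<close>
lemma different_tip_neighbours_joined:
  assumes "{(e, First, Head), (i, q)} \<in> arcs (chord_cycle n)"
    "{(e, edge_symmetry a True (First, Head)), (j, r)} \<in> arcs (chord_cycle n)"
  shows "\<exists>q' r'. {(i, q'), (j, r')} \<in> arcs (chord_cycle n)"
proof -
  have i: "i \<in> {1..n}" "e = cyc_suc n i" and j: "j \<in> {1..n}"
    using assms by (simp_all add: arc_chord_cycle_iff del: atLeastAtMost_iff One_nat_def)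
  show ?thesis
  proof (cases a)
    case True
    then have "j = cyc_suc n (cyc_suc n i)"
      using assms(2) i by (simp add: arc_chord_cycle_iff edge_symmetry_simps)
    then have "{(i, Second, Head), (j, First, Tail)} \<in> arcs (chord_cycle n)"
      using i j by (simp add: arc_chord_cycle_iff)
    then show ?thesis by blast
  next
    case False
    then have "cyc_suc n i = cyc_suc n (cyc_suc n j)"
      using assms(2) i by (simp add: arc_chord_cycle_iff edge_symmetry_simps)
    then have "i = cyc_suc n j" using i j cyc_suc_mem cyc_suc_inject by metis
    then have "{(i, First, Head), (j, Second, Tail)} \<in> arcs (chord_cycle n)"
      using i j by (simp add: arc_chord_cycle_iff)
    then show ?thesis by blast
  qed
qed

section \<open>Symmetries of the presentation\<close>

text \<open>
  If the tip pairs at \<open>e\<close> became pairs of ends with different tips at \<open>g e\<close>, then some tip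
  pair would be moved to the pair that contains the first head, whose neighbours are joined by an
  arc.  Pulled back, this arc joins the neighbours of the tip pair, which is impossible because their
  residues modulo \<open>3\<close> agree.  Here \<open>a\<close> tells whether the image pairs consist of ends of different arrows.
\<close>
lemma no_iso_moves_same_tip_pairing:
  assumes n: "3 dvd n" and g: "bij_betw g {1..n} {1..n}"
    and arcs: "image (move_ends g h) ` arcs (chord_cycle n) = arcs (chord_cycle n)"
    and e: "e \<in> {1..n}" "surj (h e)"
    and h: "\<And>p. h e (edge_symmetry True False p) = edge_symmetry a True (h e p)"
  shows False
proof -
  let ?A = "arcs (chord_cycle n)"
  have move: "{(g i, h i p), (g j, h j q)} \<in> ?A" if "{(i, p), (j, q)} \<in> ?A" for i p j q
  proof -
    have "move_ends g h ` {(i, p), (j, q)} \<in> ?A" using that arcs by blast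
    then show ?thesis by (simp add: move_ends_def)
  qed
  obtain p where p: "h e p = (First, Head)" using e(2) by (metis surjD)
  obtain i q where i: "{(e, p), (i, q)} \<in> ?A" using arc_chord_cycle_exists[OF e(1)] .
  obtain j r where j: "{(e, edge_symmetry True False p), (j, r)} \<in> ?A"
    using arc_chord_cycle_exists[OF e(1)] .
  have ij: "i \<in> {1..n}" "j \<in> {1..n}"
    using i j by (simp_all add: arc_chord_cycle_iff del: atLeastAtMost_iff One_nat_def)
  have "{(g e, First, Head), (g i, h i q)} \<in> ?A" using move[OF i] by (simp only: p)
  moreover have "{(g e, edge_symmetry a True (First, Head)), (g j, h j r)} \<in> ?A"
    using move[OF j] by (simp only: p h)
  ultimately obtain q' r' where "{(g i, q'), (g j, r')} \<in> ?A"
    using different_tip_neighbours_joined by blast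
  then have "{(g i, q'), (g j, r')} \<in> image (move_ends g h) ` ?A" by (simp only: arcs)
  then obtain c where c: "c \<in> ?A" "move_ends g h ` c = {(g i, q'), (g j, r')}"
    by (metis imageE)
  obtain i' s j' t where c': "c = {(i', s), (j', t)}" "i' \<in> {1..n}" "j' \<in> {1..n}"
    using arc_chord_cycle_cases[OF c(1)] .
  have "g i' = g i \<and> g j' = g j \<or> g i' = g j \<and> g j' = g i"
    using c(2) by (auto simp: c'(1) move_ends_def doubleton_eq_iff)
  then have "i' = i \<and> j' = j \<or> i' = j \<and> j' = i"
    using g ij c'(2,3) by (metis bij_betw_imp_inj_on inj_onD)
  then show False
    using arc_labels_mod_3[OF n] same_tip_neighbours_mod_3[OF n i j] c(1) c'(1) by metis
qed

text \<open>
  There is a single vertex: alternately following arcs and arrows leads from the first head of any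
  edge to the first head of the next one.
\<close>
lemma closed_under_vertex_boundary:
  assumes T: "\<And>x y. x \<in> T \<Longrightarrow> {x, y} \<in> arcs (chord_cycle n) \<Longrightarrow> y \<in> T"
    "\<And>e p. (e, p) \<in> T \<Longrightarrow> (e, edge_symmetry False True p) \<in> T"
    and e0: "e0 \<in> {1..n}" "(e0, p0) \<in> T"
  shows "{1..n} \<times> UNIV \<subseteq> T"
proof -
  let ?P = "\<lambda>i. (i, First, Head) \<in> T"
  have v: "(i, a, t) \<in> T" if "(i, a, t') \<in> T" for i a t t'
    using that T(2)[OF that] by (cases a; cases t; cases t') (auto simp: edge_symmetry_simps)
  obtain e where e: "e \<in> {1..n}" "?P e"
  proof (cases "fst p0")
    case First
    then have "?P e0" using v[of e0 First "snd p0"] e0(2) by (metis prod.collapse)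
    then show thesis using that e0(1) by blast
  next
    case Second
    then have "(e0, Second, Tail) \<in> T" using v[of e0 Second "snd p0"] e0(2) by (metis prod.collapse)
    then have "?P (cyc_suc n e0)"
      by (rule T(1)) (use e0(1) cyc_suc_mem[OF e0(1)] in
        \<open>simp add: arc_chord_cycle_iff del: atLeastAtMost_iff One_nat_def\<close>)
    then show thesis using that cyc_suc_mem[OF e0(1)] by blast
  qed
  have from_suc: "(i, Second, t) \<in> T" if "i \<in> {1..n}" "?P (cyc_suc n i)" for i t
  proof -
    have "(i, Second, Tail) \<in> T"
      by (rule T(1)[OF that(2)]) (use that cyc_suc_mem[OF that(1)] in
        \<open>simp add: arc_chord_cycle_iff del: atLeastAtMost_iff One_nat_def\<close>)
    then show ?thesis by (rule v)
  qed
  have step: "?P (cyc_suc n i)" if i: "i \<in> {1..n}" "?P i" for i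
  proof -
    obtain j where j: "j \<in> {1..n}" "cyc_suc n j = i" using cyc_suc_surj[OF i(1)] .
    have "(j, Second, Head) \<in> T" using from_suc j i by blast
    then have "(cyc_suc n i, First, Tail) \<in> T"
      by (rule T(1)) (use i j cyc_suc_mem[OF i(1)] in
        \<open>simp add: arc_chord_cycle_iff del: atLeastAtMost_iff One_nat_def\<close>)
    then show ?thesis by (rule v)
  qed
  have up: "?P j" if "?P i" "i \<le> j" "1 \<le> i" "j \<le> n" for i j
    using that(2,4)
  proof (induction j rule: dec_induct)
    case (step j)
    then show ?case using \<open>1 \<le> i\<close> \<open>\<And>i. i \<in> {1..n} \<Longrightarrow> ?P i \<Longrightarrow> ?P (cyc_suc n i)\<close>[of j]
      by (simp add: cyc_suc_def)
  qed (rule that)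
  have "?P n" using up[of e n] e by simp
  then have "?P 1" using step[of n] e by (simp add: cyc_suc_def)
  then have all: "?P i" if "i \<in> {1..n}" for i using up[of 1 i] that by simp
  have "(i, a, t) \<in> T" if "i \<in> {1..n}" for i a t
    using v[OF all[OF that]] from_suc[OF that all[OF cyc_suc_mem[OF that]]] by (cases a) auto
  then show ?thesis by auto
qed

text \<open>
  The first heads and second tails are the ends of the arcs between \<open>i\<close> and \<open>i - 1\<close>.  They are closed
  under arcs and under \<open>edge_symmetry True True\<close>, which follows the face boundaries, so they make up
  whole faces.  If faces became vertices, their image would contain the whole boundary of the only
  vertex, although the other half of the ends is missing.
\<close>
lemma no_iso_faces_to_vertices:
  assumes n: "n \<ge> 1" and g: "bij_betw g {1..n} {1..n}"
    and arcs: "image (move_ends g h) ` arcs (chord_cycle n) = arcs (chord_cycle n)"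
    and h: "\<And>e. e \<in> {1..n} \<Longrightarrow> inj (h e)"
      "\<And>e p. e \<in> {1..n} \<Longrightarrow> h e (edge_symmetry True True p) = edge_symmetry False True (h e p)"
  shows False
proof -
  let ?A = "arcs (chord_cycle n)"
  define S where "S = {1..n} \<times> {(First, Head), (Second, Tail)}"
  define T where "T = move_ends g h ` S"
  have inj: "inj_on (move_ends g h) ({1..n} \<times> UNIV)"
  proof (rule inj_onI)
    fix u v assume uv: "u \<in> {1..n} \<times> UNIV" "v \<in> {1..n} \<times> UNIV" "move_ends g h u = move_ends g h v"
    obtain i p j q where [simp]: "u = (i, p)" "v = (j, q)" by (cases u; cases v)
    have "g i = g j" "h i p = h j q" using uv(3) by (simp_all add: move_ends_def)
    moreover have "i \<in> {1..n}" "j \<in> {1..n}" using uv(1,2) by simp_all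
    ultimately have "i = j" "h i p = h i q" using bij_betw_imp_inj_on[OF g] by (auto dest: inj_onD)
    then show "u = v" using h(1)[OF \<open>i \<in> {1..n}\<close>] by (simp add: inj_eq)
  qed
  have S_arc: "y \<in> S" if "x \<in> S" "{x, y} \<in> ?A" for x y
    using that by (cases x; cases y) (auto simp: S_def arc_chord_cycle_iff)
  have T_arc: "y \<in> T" if x: "x \<in> T" "{x, y} \<in> ?A" for x y
  proof -
    obtain x' where x': "x = move_ends g h x'" "x' \<in> S" using x(1) by (auto simp: T_def)
    have "{x, y} \<in> image (move_ends g h) ` ?A" using x(2) by (simp only: arcs)
    then obtain c where c: "c \<in> ?A" "{x, y} = move_ends g h ` c" by (metis imageE)
    obtain u v where uv: "c = {u, v}" "u \<in> {1..n} \<times> UNIV" "v \<in> {1..n} \<times> UNIV"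
      using arc_chord_cycle_cases[OF c(1)] by (metis SigmaI UNIV_I)
    have "x' \<in> {1..n} \<times> UNIV" using x'(2) by (auto simp: S_def)
    moreover have "move_ends g h x' = move_ends g h u \<or> move_ends g h x' = move_ends g h v"
      using c(2) unfolding uv(1) x'(1) by blast
    ultimately have "x' = u \<or> x' = v" using uv(2,3) inj by (metis inj_onD)
    then have "u \<in> S \<and> v \<in> S"
    proof
      assume "x' = u"
      then show ?thesis using S_arc[of u v] x'(2) c(1) uv(1) by blast
    next
      assume "x' = v"
      then show ?thesis using S_arc[of v u] x'(2) c(1) uv(1) by (simp add: insert_commute)
    qed
    moreover have "y \<in> move_ends g h ` {u, v}" using c(2) uv(1) by blast
    ultimately show ?thesis by (auto simp: T_def)
  qed
  have T_v: "(e, edge_symmetry False True p) \<in> T" if ep: "(e, p) \<in> T" for e p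
  proof -
    obtain e' p' where e': "(e', p') \<in> S" "e = g e'" "p = h e' p'"
      using ep by (auto simp: T_def move_ends_def)
    then have "(e', edge_symmetry True True p') \<in> S" by (auto simp: S_def edge_symmetry_simps)
    moreover have "(e, edge_symmetry False True p) = move_ends g h (e', edge_symmetry True True p')"
      using e' h(2) by (auto simp: S_def move_ends_def)
    ultimately show ?thesis by (auto simp: T_def)
  qed
  have "(1, First, Head) \<in> S" using n by (simp add: S_def)
  then have "(g 1, h 1 (First, Head)) \<in> T" unfolding T_def move_ends_def by force
  moreover have "g 1 \<in> {1..n}" using bij_betwE[OF g] n by simp
  ultimately have all: "{1..n} \<times> UNIV \<subseteq> T"
    by (intro closed_under_vertex_boundary[OF T_arc T_v])
  have "move_ends g h (1, First, Tail) \<in> T"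
    using all \<open>g 1 \<in> {1..n}\<close> by (auto simp: move_ends_def)
  then obtain x where x: "x \<in> S" "move_ends g h (1, First, Tail) = move_ends g h x"
    by (auto simp: T_def)
  then have "(1, First, Tail) = x"
    using n by (intro inj_onD[OF inj x(2)]) (auto simp: S_def)
  then show False using x(1) by (auto simp: S_def)
qed

lemma surj_of_inj_end: "inj f \<Longrightarrow> surj (f :: arrow \<times> tip \<Rightarrow> arrow \<times> tip)"
proof -
  have "(UNIV :: (arrow \<times> tip) set) = {First, Second} \<times> {Tail, Head}"
    using arrow.exhaust tip.exhaust by auto
  moreover have "finite ({First, Second} \<times> {Tail, Head})" by simp
  ultimately have "finite (UNIV :: (arrow \<times> tip) set)" by simp
  then show "inj f \<Longrightarrow> surj f" by (rule finite_UNIV_inj_surj)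
qed

text \<open>
  Each of the three involutions interchanges two of the three splittings of the ends of an edge into
  pairs and fixes the third; the one that fixes the tip pairs is $\delta$.
\<close>
lemma no_reflection_symmetry:
  assumes n: "3 dvd n" "n \<ge> 1" and iso: "ribbon_iso g (apply_ops f (chord_cycle n)) (chord_cycle n)"
    and f: "\<And>e. e \<in> {1..n} \<Longrightarrow> f e \<in> {Dual, Twist, DualTwistDual}"
  shows False
proof -
  obtain x y where g: "bij_betw g {1..n} {1..n}" and
    xy: "image (move_ends g (\<lambda>e. edge_symmetry (x e) (y e))) ` arcs (apply_ops f (chord_cycle n)) =
      arcs (chord_cycle n)"
    using iso by (auto simp: ribbon_iso_def apply_ops_def)
  define h where "h e = edge_symmetry (x e) (y e) \<circ> op_end (f e)" for e
  have arcs: "image (move_ends g h) ` arcs (chord_cycle n) = arcs (chord_cycle n)"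
    using xy by (simp add: apply_ops_def move_ends_comp_image h_def[abs_def] del: o_apply)
  have inj: "inj (h e)" for e
    unfolding h_def by (intro inj_compose inj_edge_symmetry inj_op_end)
  have "f e = Dual" if e: "e \<in> {1..n}" for e
  proof (rule ccontr)
    assume "f e \<noteq> Dual"
    then consider "f e = Twist" | "f e = DualTwistDual" using f[OF e] by blast
    then show False
    proof cases
      case 1
      then have "h e (edge_symmetry True False p) = edge_symmetry True True (h e p)" for p
        by (simp add: h_def twist_end_edge_symmetry edge_symmetry_comp)
      then show False by (rule no_iso_moves_same_tip_pairing[OF n(1) g arcs e surj_of_inj_end[OF inj]])
    next
      case 2
      then have "h e (edge_symmetry True False p) = edge_symmetry False True (h e p)" for p
        by (simp add: h_def twist_end_edge_symmetry dual_end_edge_symmetry edge_symmetry_comp)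
      then show False by (rule no_iso_moves_same_tip_pairing[OF n(1) g arcs e surj_of_inj_end[OF inj]])
    qed
  qed
  then have "h e (edge_symmetry True True p) = edge_symmetry False True (h e p)"
    if "e \<in> {1..n}" for e p
    using that by (simp add: h_def dual_end_edge_symmetry edge_symmetry_comp)
  then show False by (rule no_iso_faces_to_vertices[OF n(2) g arcs inj])
qed

text \<open>
  Conjugation by \<open>alpha\<close> turns a self-duality into a symmetry of \<open>chord_cycle\<close> to which
  \<open>no_reflection_symmetry\<close> applies, as multiplying $\delta$ on both
  sides by powers of $\delta\tau$ gives an involution.
\<close>
lemma not_self_dual_alpha_chord_cycle:
  assumes "k \<ge> 1"
  shows "\<not> self_dual (3 * k)
     (act (3 * k) (alpha k, id) (ordered_class (3 * k) (chord_cycle (3 * k), \<lambda>i. i)))"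
proof
  let ?M = "chord_cycle (3 * k)"
  let ?act = "act (3 * k)" and ?C = "ordered_class (3 * k) (?M, \<lambda>i. i)"
  \<comment> \<open>The values of \<open>alpha\<close> have order one or three, so their squares are their inverses.\<close>
  let ?b = "\<lambda>i. alpha k i * alpha k i"
  note og = ordered_graph_chord_cycle[of "3 * k"]
  assume "self_dual (3 * k) (?act (alpha k, id) ?C)"
  then obtain \<pi> where \<pi>: "\<pi> permutes {1..3 * k}"
    and D: "?act (\<lambda>_. Dual, \<pi>) (?act (alpha k, id) ?C) = ?act (alpha k, id) ?C"
    by (auto simp: self_dual_def)
  let ?\<gamma> = "\<lambda>i. ?b i * (Dual * alpha k (inv \<pi> i))"
  have "?act (?\<gamma>, \<pi>) ?C = ?act (?b, id) (?act (\<lambda>i. Dual * alpha k (inv \<pi> i), \<pi>) ?C)"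
    using act_mult[OF og, of "(?b, id)" "(\<lambda>i. Dual * alpha k (inv \<pi> i), \<pi>)"] \<pi>
    by (simp add: permutes_id del: times_ribbon_op.simps)
  also have "?act (\<lambda>i. Dual * alpha k (inv \<pi> i), \<pi>) ?C = ?act (alpha k, id) ?C"
    using act_mult[OF og, of "(\<lambda>_. Dual, \<pi>)" "(alpha k, id)"] \<pi> D
    by (simp add: permutes_id del: times_ribbon_op.simps)
  also have "?act (?b, id) \<dots> = ?act (\<lambda>i. ?b i * alpha k i, id) ?C"
    using act_mult[OF og, of "(?b, id)" "(alpha k, id)"]
    by (simp add: permutes_id del: times_ribbon_op.simps)
  also have "(\<lambda>i. ?b i * alpha k i) = (\<lambda>_. Unit)"
    by (auto simp: alpha_def one_ribbon_op_def)
  also have "?act (\<lambda>_. Unit, id) ?C = ?C" by (rule act_one[OF og])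
  finally have "ordered_class (3 * k) (act_graph (3 * k) (?\<gamma>, \<pi>) (?M, \<lambda>i. i)) = ?C"
    using act_ordered_class[OF og, of "(?\<gamma>, \<pi>)"] \<pi> by simp
  then have "(act_graph (3 * k) (?\<gamma>, \<pi>) (?M, \<lambda>i. i), (?M, \<lambda>i. i)) \<in> ordered_iso (3 * k)"
    unfolding ordered_class_def using og by (intro eq_equiv_class[OF _ equiv_ordered_iso]) auto
  then obtain g where
    "ribbon_iso g (apply_ops (ops_along (3 * k) ?\<gamma> ((\<lambda>i. i) \<circ> inv \<pi>)) ?M) ?M"
    by (auto simp: ordered_iso_def)
  moreover have "?\<gamma> i \<in> {Dual, Twist, DualTwistDual}" for i
    by (simp add: alpha_def one_ribbon_op_def)
  then have "ops_along (3 * k) ?\<gamma> l e \<in> {Dual, Twist, DualTwistDual}" for l and e :: nat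
    unfolding ops_along_def .
  ultimately show False
    using assms by (intro no_reflection_symmetry[of "3 * k"]) simp_all
qed

theorem proposition7p1:
  fixes k :: nat
  assumes "k \<ge> 1"
  shows "self_trial (3 * k) (act (3 * k) (alpha k, id) (ordered_class (3 * k) (H_graph k))) \<and>
         \<not> self_dual (3 * k) (act (3 * k) (alpha k, id) (ordered_class (3 * k) (H_graph k)))"
  unfolding ordered_class_H_graph[OF assms]
  using self_trial_alpha_chord_cycle not_self_dual_alpha_chord_cycle[OF assms] by blast

end
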